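(* Let $G$ be a connected recurrent graph with a distinguished vertex $o$. Let $(B_r)_r$ be an increasing sequence of sets of vertices of $G$ such that $B_r\ne G$ for all $r$ and $\bigcup_r B_r=G$. Suppose that there exists $C<\infty$ such that for all $r$ $$g_{B_r}(x,x)\le C\,g_{B_r}(o,o)\quad\text{for all }x\in B_r .$$ Then $G$ has the infinite collision property. Moreover, for two independent simple random walks $X,Y$ on $G$ started at the same vertex, the number of edges crossed at the same time by the two walks, $\sum_{t=0}^\infty \mathbf{1}(X_t=Y_t,\ X_{t+1}=Y_{t+1})$, is infinite a.s.
   Context: $G$ is (locally finite and) recurrent if discrete-time simple random walk on $G$ is recurrent. $d(x)$ denotes the degree of a vertex $x$. For a set $B$ of vertices, let $q^B_t(x,y)=P_x(X_t=y,\ t<\tau_B)/d(y)$, where $X$ is simple random walk started at $x$ and $\tau_B=\inf\{t\ge 0: X_t\notin B\}$ (the walk killed on exiting $B$), and let $g_B(x,y)=\sum_{t=0}^\infty q^B_t(x,y)$ be the Green kernel. Infinite collision property: let $X,Y$ be independent discrete-time simple random walks on $G$, let $P_{a,b}$ be their joint law when $X_0=a$, $Y_0=b$, and let $Z=\sum_{t=0}^{\infty}\mathbf{1}(X_t=Y_t)$. $G$ has the infinite collision property if $P_{a,a}(Z=\infty)=1$ for all vertices $a$. *)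

theory Defs
  imports "HOL-Probability.Probability"
begin

locale locally_finite_graph =
  fixes V :: "'a set" and adj :: "'a \<Rightarrow> 'a \<Rightarrow> bool"
  assumes adj_in_V: "adj x y \<Longrightarrow> x \<in> V \<and> y \<in> V"
    and adj_sym: "adj x y \<Longrightarrow> adj y x"
    and adj_irrefl: "\<not> adj x x"
    and finite_nbrs: "finite {y. adj x y}"

definition nbrs :: "('a \<Rightarrow> 'a \<Rightarrow> bool) \<Rightarrow> 'a \<Rightarrow> 'a set" where
  "nbrs adj x = {y. adj x y}"

definition deg :: "('a \<Rightarrow> 'a \<Rightarrow> bool) \<Rightarrow> 'a \<Rightarrow> nat" where
  "deg adj x = card (nbrs adj x)"

definition connected_graph :: "'a set \<Rightarrow> ('a \<Rightarrow> 'a \<Rightarrow> bool) \<Rightarrow> bool" where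
  "connected_graph V adj \<longleftrightarrow> (\<forall>x\<in>V. \<forall>y\<in>V. adj\<^sup>*\<^sup>* x y)"

text \<open>Conditional law of \<open>X\<^sub>i\<close> given \<open>X\<^sub>0, \<dots>, X\<^sub>i\<^sub>-\<^sub>1\<close> for simple random walk started at \<open>a\<close>.
  It is the intended one only where \<open>nbrs adj\<close> is finite and nonempty; in a connected
  locally finite graph the only exception is the graph with a single vertex.\<close>

definition srw_step :: "('a \<Rightarrow> 'a \<Rightarrow> bool) \<Rightarrow> 'a \<Rightarrow> nat \<Rightarrow> (nat \<Rightarrow> 'a) \<Rightarrow> 'a pmf" where
  "srw_step adj a i \<omega> = (case i of 0 \<Rightarrow> return_pmf a | Suc j \<Rightarrow> pmf_of_set (nbrs adj (\<omega> j)))"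

text \<open>The law \<open>P\<^sub>a\<close> on trajectories, as the Ionescu-Tulcea limit of these conditional laws;
  lemma \<open>emeasure_srw_cylinder\<close> below gives its finite-dimensional distributions.\<close>

definition srw :: "('a \<Rightarrow> 'a \<Rightarrow> bool) \<Rightarrow> 'a \<Rightarrow> (nat \<Rightarrow> 'a) measure" where
  "srw adj a = projective_family.lim UNIV
     (Ionescu_Tulcea.CI (\<lambda>i \<omega>. measure_pmf (srw_step adj a i \<omega>)) (\<lambda>_. count_space UNIV))
     (\<lambda>_. count_space UNIV)"

definition srw_pair :: "('a \<Rightarrow> 'a \<Rightarrow> bool) \<Rightarrow> 'a \<Rightarrow> 'a \<Rightarrow> ((nat \<Rightarrow> 'a) \<times> (nat \<Rightarrow> 'a)) measure" where
  "srw_pair adj a b = srw adj a \<Otimes>\<^sub>M srw adj b"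

definition recurrent_graph :: "'a set \<Rightarrow> ('a \<Rightarrow> 'a \<Rightarrow> bool) \<Rightarrow> bool" where
  "recurrent_graph V adj \<longleftrightarrow> (\<forall>x\<in>V. AE X in srw adj x. \<exists>t\<ge>1. X t = x)"

definition exit_time :: "'a set \<Rightarrow> (nat \<Rightarrow> 'a) \<Rightarrow> enat" where
  "exit_time B X = Inf {enat t | t. X t \<notin> B}"

definition killed_kernel ::
    "('a \<Rightarrow> 'a \<Rightarrow> bool) \<Rightarrow> 'a set \<Rightarrow> nat \<Rightarrow> 'a \<Rightarrow> 'a \<Rightarrow> ennreal" where
  "killed_kernel adj B t x y =
     emeasure (srw adj x) {X \<in> space (srw adj x). X t = y \<and> enat t < exit_time B X}
       / of_nat (deg adj y)"

definition green :: "('a \<Rightarrow> 'a \<Rightarrow> bool) \<Rightarrow> 'a set \<Rightarrow> 'a \<Rightarrow> 'a \<Rightarrow> ennreal" where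
  "green adj B x y = (\<Sum>t. killed_kernel adj B t x y)"

definition collisions :: "(nat \<Rightarrow> 'a) \<Rightarrow> (nat \<Rightarrow> 'a) \<Rightarrow> ennreal" where
  "collisions X Y = (\<Sum>t. of_bool (X t = Y t))"

definition edge_collisions :: "(nat \<Rightarrow> 'a) \<Rightarrow> (nat \<Rightarrow> 'a) \<Rightarrow> ennreal" where
  "edge_collisions X Y = (\<Sum>t. of_bool (X t = Y t \<and> X (Suc t) = Y (Suc t)))"

definition infinite_collision_property :: "'a set \<Rightarrow> ('a \<Rightarrow> 'a \<Rightarrow> bool) \<Rightarrow> bool" where
  "infinite_collision_property V adj \<longleftrightarrow>
     (\<forall>a\<in>V. AE (X, Y) in srw_pair adj a a. collisions X Y = \<infinity>)"

lemma Ionescu_Tulcea_srw: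
  "Ionescu_Tulcea (\<lambda>i \<omega>. measure_pmf (srw_step adj a i \<omega>)) (\<lambda>_. count_space UNIV)"
proof (rule Ionescu_Tulcea.intro)
  fix i
  show "(\<lambda>\<omega>. measure_pmf (srw_step adj a i \<omega>))
      \<in> PiM {0..<i} (\<lambda>_. count_space UNIV) \<rightarrow>\<^sub>M subprob_algebra (count_space UNIV)"
  proof (cases i)
    case 0
    then show ?thesis
      by (simp add: srw_step_def measure_pmf_in_subprob_algebra)
  next
    case (Suc j)
    have 1: "(\<lambda>\<omega>. \<omega> j) \<in> PiM {0..<i} (\<lambda>_. count_space UNIV) \<rightarrow>\<^sub>M count_space UNIV"
      using Suc by (intro measurable_component_singleton) auto
    have 2: "(\<lambda>x. measure_pmf (pmf_of_set (nbrs adj x)))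
        \<in> count_space UNIV \<rightarrow>\<^sub>M subprob_algebra (count_space UNIV)"
      by (simp add: measure_pmf_in_subprob_algebra)
    show ?thesis
      using measurable_compose[OF 1 2] by (simp add: srw_step_def Suc)
  qed
qed (rule prob_space_measure_pmf)

lemma sets_srw: "sets (srw adj a) = sets (PiM UNIV (\<lambda>_. count_space UNIV))"
  and space_srw: "space (srw adj a) = UNIV"
  and prob_space_srw: "prob_space (srw adj a)"
proof -
  interpret Ionescu_Tulcea "\<lambda>i \<omega>. measure_pmf (srw_step adj a i \<omega>)" "\<lambda>_. count_space UNIV"
    by (rule Ionescu_Tulcea_srw)
  show s: "sets (srw adj a) = sets (PiM UNIV (\<lambda>_. count_space UNIV))"
    unfolding srw_def by (rule PF.sets_lim)
  show "space (srw adj a) = UNIV"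
    using sets_eq_imp_space_eq[OF s] by (simp add: space_PiM)
  have "emeasure PF.lim (PF.emb UNIV {} (space (PiM {} (\<lambda>_. count_space UNIV)))) = 1"
    using prob_space.emeasure_space_1[OF PF.prob_space_P, of "{}"] by (subst lim) (simp_all add: CI_def)
  then show "prob_space (srw adj a)"
    unfolding srw_def by (intro prob_spaceI) (simp add: PF.space_lim prod_emb_def space_PiM vimage_def restrict_def)
qed

lemma emeasure_srw_cylinder:
  "emeasure (srw adj a) {X. \<forall>i\<le>n. X i = p i} =
     of_bool (p 0 = a) * (\<Prod>i<n. ennreal (pmf (pmf_of_set (nbrs adj (p i))) (p (Suc i))))"
proof -
  let ?M = "\<lambda>_::nat. count_space (UNIV :: 'a set)"
  interpret Ionescu_Tulcea "\<lambda>i \<omega>. measure_pmf (srw_step adj a i \<omega>)" ?M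
    by (rule Ionescu_Tulcea_srw)
  let ?S = "\<lambda>n. {restrict p {0..<n}}"
  let ?u = "\<lambda>_::nat. undefined :: 'a"
  have S: "?S n \<in> sets (PiM {0..<n} ?M)" for n
  proof -
    have "?S n = PiE {0..<n} (\<lambda>i. {p i})"
      by (auto simp: PiE_iff extensional_def restrict_def fun_eq_iff)
    also have "\<dots> \<in> sets (PiM {0..<n} ?M)" by (intro sets_PiM_I_finite) auto
    finally show ?thesis .
  qed
  have u: "?u \<in> space (PiM {0..<0} ?M)" by (simp add: space_PiM)
  have step: "emeasure (C 0 (Suc n) ?u) (?S (Suc n)) =
      emeasure (C 0 n ?u) (?S n) * pmf (srw_step adj a n p) (p n)" for n
  proof -
    have "emeasure (C 0 (Suc n) ?u) (?S (Suc n)) = 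
        (\<integral>\<^sup>+\<omega>. emeasure (eP n \<omega>) (?S (Suc n)) \<partial>C 0 n ?u)"
    proof -
      have "eP n \<in> C 0 n ?u \<rightarrow>\<^sub>M subprob_algebra (PiM {0..<Suc n} ?M)"
        using measurable_eP[of n] measurable_cong_sets[OF sets_C[OF u, of n] refl, unfolded add_0] by blast
      moreover have "space (C 0 n ?u) \<noteq> {}"
        using prob_space_C[OF u, of n] by (rule prob_space.not_empty)
      ultimately show ?thesis
        using emeasure_bind[of "C 0 n ?u" "eP n" "PiM {0..<Suc n} ?M" "?S (Suc n)"] S[of "Suc n"]
        by simp
    qed
    also have "\<dots> = (\<integral>\<^sup>+\<omega>. ennreal (pmf (srw_step adj a n p) (p n)) * indicator (?S n) \<omega> \<partial>C 0 n ?u)"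
    proof (intro nn_integral_cong)
      fix \<omega> assume "\<omega> \<in> space (C 0 n ?u)"
      then have w: "\<omega> \<in> space (PiM {0..<n} ?M)" using space_C[OF u, of n] by simp
      then have ext: "\<omega> k = undefined" if "k \<ge> n" for k
        using that by (auto simp: space_PiM PiE_iff extensional_def)
      have eq: "fun_upd \<omega> n x = restrict p {0..<Suc n} \<longleftrightarrow> \<omega> = restrict p {0..<n} \<and> x = p n" for x
        using ext by (auto simp: fun_eq_iff restrict_def split: if_splits)
      have "emeasure (eP n \<omega>) (?S (Suc n)) =
          emeasure (measure_pmf (srw_step adj a n \<omega>)) {x. \<omega> = restrict p {0..<n} \<and> x = p n}"
        by (subst emeasure_eP[OF w S]) (simp add: vimage_def eq)
      also have "\<dots> = ennreal (pmf (srw_step adj a n p) (p n)) * indicator (?S n) \<omega>"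
        by (cases "\<omega> = restrict p {0..<n}")
           (auto simp: emeasure_pmf_single srw_step_def split: nat.split)
      finally show "emeasure (eP n \<omega>) (?S (Suc n)) = \<dots>" .
    qed
    also have "\<dots> = emeasure (C 0 n ?u) (?S n) * pmf (srw_step adj a n p) (p n)"
      using S[of n] sets_C[OF u, of n] by (subst nn_integral_cmult_indicator) (auto simp: mult.commute)
    finally show ?thesis .
  qed
  have C: "emeasure (C 0 (Suc n) ?u) (?S (Suc n)) = of_bool (p 0 = a) *
      (\<Prod>i<n. ennreal (pmf (pmf_of_set (nbrs adj (p i))) (p (Suc i))))" for n
  proof (induction n)
    case 0
    have "emeasure (C 0 0 ?u) (?S 0) = 1"
      using S[of 0] by (simp add: restrict_def)
    then show ?case
      by (subst step) (auto simp: srw_step_def)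
  next
    case (Suc n)
    have "srw_step adj a (Suc n) p = pmf_of_set (nbrs adj (p n))"
      by (simp add: srw_step_def)
    then show ?case
      unfolding step[of "Suc n"] Suc by (simp only: prod.lessThan_Suc mult.assoc)
  qed
  have "{X. \<forall>i\<le>n. X i = p i} = PF.emb UNIV {0..<Suc n} (?S (Suc n))"
    by (auto simp: prod_emb_def restrict_def fun_eq_iff less_Suc_eq_le)
       (metis less_Suc_eq_le)+
  then have "emeasure (srw adj a) {X. \<forall>i\<le>n. X i = p i} = emeasure (CI {0..<Suc n}) (?S (Suc n))"
    unfolding srw_def using lim[OF _ S[of "Suc n"]] by simp
  also have "\<dots> = emeasure (C 0 (Suc n) ?u) (?S (Suc n))"
    using emeasure_CI[of "{0..<Suc n}" "Suc n", OF _ S[of "Suc n"]] S[of "Suc n"]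
    by (simp add: prod_emb_id sets.sets_into_space del: C.simps)
  finally show ?thesis using C by simp
qed

end

theory Submission
  imports Defs
begin

text \<open>
  For two walks started at \<open>a\<close> and \<open>b\<close>, both killed on leaving \<open>B\<close>, the probability of sitting at a
  common vertex \<open>z\<close> at time \<open>t\<close> and then crossing the same edge is \<open>q\<^sub>t(a,z) d(z) q\<^sub>t(b,z)\<close>; summed over
  \<open>z\<close> it is \<open>q\<^sub>2\<^sub>t(a,b)\<close>. So the expected number of common edge crossings is
  \<open>s(a,b) = \<Sum>\<^sub>t q\<^sub>2\<^sub>t(a,b)\<close>, and after each crossing at most \<open>max\<^sub>y s(y,y)\<close> further ones are
  expected. Hence at least one crossing occurs with probability at least
  \<open>s(a,b) / (1 + max\<^sub>y s(y,y)) \<ge> s(a,b) / (1 + C g(o,o))\<close>, where \<open>g = g\<^sub>B\<close>.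

  By the maximum principle \<open>g(a,a) \<le> 2 s(a,a)\<close>, and Harnack-type gradient bounds along a path
  show that \<open>g(a,a)\<close> differs from \<open>g(o,o)\<close>, and \<open>s(a,b)\<close> from \<open>s(a,a)\<close>, by at most a constant
  that does not depend on \<open>B\<close>, as long as \<open>a\<close> and \<open>b\<close> are joined by a path of even length. Recurrence
  makes \<open>g(o,o)\<close> tend to infinity along \<open>B\<^sub>r\<close>, so the crossing probability is bounded below by
  \<open>c = 1/(8(1+C))\<close>, uniformly over all such pairs. By the Markov property the probability
  \<open>U\<close> of no crossing satisfies \<open>U \<le> (1 - c) U\<close>, so it vanishes, and by the Markov
  property again there is almost surely a crossing after every time \<open>n\<close>.
\<close>

section \<open>Averaging over neighbours and the killed kernel\<close>

text \<open>With every degree of a vertex positive, \<open>avg\<close> is a true average and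
  \<open>pmf_of_set (nbrs adj x)\<close> is the uniform law on the neighbours.\<close>

locale graph_without_isolated_vertices = locally_finite_graph +
  assumes nbrs_nonempty: "x \<in> V \<Longrightarrow> nbrs adj x \<noteq> {}"
begin

definition avg :: "('a \<Rightarrow> real) \<Rightarrow> 'a \<Rightarrow> real" where
  "avg f x = (\<Sum>y\<in>nbrs adj x. f y) / deg adj x"

lemma finite_nbrs_set [simp]: "finite (nbrs adj x)"
  using finite_nbrs by (simp add: nbrs_def)

lemma mem_nbrs: "y \<in> nbrs adj x \<longleftrightarrow> adj x y"
  by (simp add: nbrs_def)

lemma nbrs_in_V: "y \<in> nbrs adj x \<Longrightarrow> y \<in> V"
  using adj_in_V by (auto simp: nbrs_def)

lemma deg_pos: "x \<in> V \<Longrightarrow> deg adj x > 0"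
  using nbrs_nonempty by (simp add: deg_def card_gt_0_iff)

lemma avg_add: "avg (\<lambda>y. f y + g y) x = avg f x + avg g x"
  by (simp add: avg_def sum.distrib add_divide_distrib)

lemma avg_diff: "avg (\<lambda>y. f y - g y) x = avg f x - avg g x"
  by (simp add: avg_def sum_subtractf diff_divide_distrib)

lemma avg_cmult: "avg (\<lambda>y. c * f y) x = c * avg f x"
  by (simp add: avg_def sum_distrib_left)

lemma avg_sum: "avg (\<lambda>y. \<Sum>i\<in>I. f i y) x = (\<Sum>i\<in>I. avg (f i) x)"
  by (simp add: avg_def sum.swap[of _ _ I] sum_divide_distrib)

lemma avg_const: "x \<in> V \<Longrightarrow> avg (\<lambda>_. c) x = c"
  using nbrs_nonempty[of x] by (auto simp: avg_def deg_def)

lemma avg_mono: "(\<And>y. y \<in> nbrs adj x \<Longrightarrow> f y \<le> g y) \<Longrightarrow> avg f x \<le> avg g x"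
  by (simp add: avg_def divide_right_mono sum_mono)

lemma avg_cong: "(\<And>y. y \<in> nbrs adj x \<Longrightarrow> f y = g y) \<Longrightarrow> avg f x = avg g x"
  by (simp add: avg_def)

lemma avg_nonneg: "(\<And>y. y \<in> nbrs adj x \<Longrightarrow> 0 \<le> f y) \<Longrightarrow> 0 \<le> avg f x"
  by (simp add: avg_def sum_nonneg)

lemma avg_le: "x \<in> V \<Longrightarrow> (\<And>y. y \<in> nbrs adj x \<Longrightarrow> f y \<le> c) \<Longrightarrow> avg f x \<le> c"
  using avg_mono[of x f "\<lambda>_. c"] by (simp add: avg_const)

text \<open>One nonnegative term is at most the whole sum. This one-step Harnack inequality is the
  source of all gradient bounds below.\<close>

lemma le_deg_mult_avg:
  assumes "\<And>y. y \<in> nbrs adj x \<Longrightarrow> 0 \<le> f y" and "y \<in> nbrs adj x"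
  shows "f y \<le> deg adj x * avg f x"
proof -
  have "f y \<le> sum f (nbrs adj x)"
    using assms by (intro member_le_sum) auto
  moreover have "deg adj x > 0"
    using assms(2) by (auto simp: deg_def card_gt_0_iff)
  ultimately show ?thesis
    by (simp add: avg_def)
qed

lemma avg_swap: "avg (\<lambda>y. avg (f y) b) a = avg (\<lambda>z. avg (\<lambda>y. f y z) a) b"
  by (simp add: avg_def sum_divide_distrib[symmetric] sum.swap[of _ "nbrs adj a"] mult.commute)

lemma tendsto_avg:
  "(\<And>y. y \<in> nbrs adj x \<Longrightarrow> (\<lambda>n. f n y) \<longlonglongrightarrow> g y) \<Longrightarrow> (\<lambda>n. avg (f n) x) \<longlonglongrightarrow> avg g x"
  unfolding avg_def divide_inverse by (intro tendsto_mult tendsto_sum tendsto_const)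

text \<open>First-step recursion for the kernel q of the walk killed outside \<open>B\<close>,
  real-valued so that it can be subtracted; \<open>killed_kernel_eq\<close> ties it to the law of
  the walk.\<close>

primrec killed :: "'a set \<Rightarrow> nat \<Rightarrow> 'a \<Rightarrow> 'a \<Rightarrow> real" where
  "killed B 0 x y = of_bool (x = y \<and> x \<in> B) / deg adj y"
| "killed B (Suc t) x y = of_bool (x \<in> B) * avg (\<lambda>z. killed B t z y) x"

lemma killed_nonneg: "0 \<le> killed B t x y"
  by (induction t arbitrary: x) (auto intro: avg_nonneg)

lemma killed_outside: "x \<notin> B \<Longrightarrow> killed B t x y = 0"
  by (cases t) auto

text \<open>Reversibility: dividing by the degree of the target makes the one-step kernel symmetric,
  so a step can be peeled off at either end. The induction exchanges the two averages by
  \<open>avg_swap\<close>.\<close>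

lemma killed_last_step: "killed B (Suc t) x y = of_bool (y \<in> B) * avg (killed B t x) y"
proof (induction t arbitrary: x)
  case 0
  have "avg (\<lambda>z. killed B 0 z y) x = of_bool (y \<in> B \<and> adj x y) / (deg adj x * deg adj y)"
  proof -
    have "(\<Sum>z\<in>nbrs adj x. killed B 0 z y) = (\<Sum>z\<in>nbrs adj x. if z = y then of_bool (y \<in> B) / deg adj y else 0)"
      by (intro sum.cong) auto
    then show ?thesis
      by (auto simp: avg_def mem_nbrs)
  qed
  moreover have "avg (killed B 0 x) y = of_bool (x \<in> B \<and> adj y x) / (deg adj x * deg adj y)"
  proof -
    have "(\<Sum>z\<in>nbrs adj y. killed B 0 x z) = (\<Sum>z\<in>nbrs adj y. if z = x then of_bool (x \<in> B) / deg adj x else 0)"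
      by (intro sum.cong) auto
    then show ?thesis
      by (auto simp: avg_def mem_nbrs)
  qed
  ultimately show ?case
    using adj_sym by (auto simp del: killed.simps(1))
next
  case (Suc t)
  have "killed B (Suc (Suc t)) x y = of_bool (x \<in> B) * avg (\<lambda>z. of_bool (y \<in> B) * avg (killed B t z) y) x"
    by (subst killed.simps(2)) (simp only: Suc)
  also have "\<dots> = of_bool (y \<in> B) * avg (\<lambda>w. of_bool (x \<in> B) * avg (\<lambda>z. killed B t z w) x) y"
    by (simp only: avg_cmult avg_swap[of _ y x]) simp
  finally show ?case
    by simp
qed

lemma killed_sym: "killed B t x y = killed B t y x"
proof (induction t arbitrary: x y)
  case (Suc t)
  have "killed B (Suc t) x y = of_bool (x \<in> B) * avg (killed B t y) x"
    by (subst killed.simps(2)) (simp only: Suc[of _ y])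
  then show ?case
    by (simp only: killed_last_step[of B t y x])
qed auto

section \<open>Truncated Green kernels\<close>

text \<open>A finite horizon keeps every quantity real, so the maximum principles do not presuppose
  that the Green kernel is finite.\<close>

definition gsum :: "'a set \<Rightarrow> nat \<Rightarrow> 'a \<Rightarrow> 'a \<Rightarrow> real" where
  "gsum B T x y = (\<Sum>t<T. killed B t x y)"

text \<open>The expected number of edges crossed simultaneously before time \<open>T\<close> by two walks killed
  on leaving \<open>B\<close>.\<close>

definition esum :: "'a set \<Rightarrow> nat \<Rightarrow> 'a \<Rightarrow> 'a \<Rightarrow> real" where
  "esum B T x y = (\<Sum>t<T. killed B (2 * t) x y)"

lemma gsum_0 [simp]: "gsum B 0 x y = 0"
  by (simp add: gsum_def)

lemma esum_0 [simp]: "esum B 0 x y = 0"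
  by (simp add: esum_def)

lemma gsum_nonneg: "0 \<le> gsum B T x y"
  by (simp add: gsum_def sum_nonneg killed_nonneg)

lemma esum_nonneg: "0 \<le> esum B T x y"
  by (simp add: esum_def sum_nonneg killed_nonneg)

lemma gsum_sym: "gsum B T x y = gsum B T y x"
  by (simp add: gsum_def killed_sym[of B _ x y])

lemma esum_sym: "esum B T x y = esum B T y x"
  by (simp add: esum_def killed_sym[of B _ x y])

lemma gsum_outside: "x \<notin> B \<Longrightarrow> gsum B T x y = 0"
  by (simp add: gsum_def killed_outside)

lemma esum_outside: "x \<notin> B \<Longrightarrow> esum B T x y = 0"
  by (simp add: esum_def killed_outside)

lemma gsum_mono: "S \<le> T \<Longrightarrow> gsum B S x y \<le> gsum B T x y"
  unfolding gsum_def by (intro sum_mono2) (auto simp: killed_nonneg)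

lemma esum_mono: "S \<le> T \<Longrightarrow> esum B S x y \<le> esum B T x y"
  unfolding esum_def by (intro sum_mono2) (auto simp: killed_nonneg)

lemma gsum_Suc:
  "gsum B (Suc T) x y = of_bool (x = y \<and> x \<in> B) / deg adj y + of_bool (x \<in> B) * avg (\<lambda>z. gsum B T z y) x"
  by (simp add: gsum_def sum.lessThan_Suc_shift avg_sum sum_distrib_left del: sum.lessThan_Suc)

text \<open>Both steps are taken at the end \<open>x\<close>, the form suited to a maximum principle
  in \<open>x\<close> with \<open>y\<close> fixed.\<close>

lemma esum_Suc:
  "esum B (Suc T) x y = of_bool (x = y \<and> x \<in> B) / deg adj y
     + of_bool (x \<in> B) * avg (\<lambda>z. of_bool (z \<in> B) * avg (\<lambda>w. esum B T w y) z) x"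
proof -
  have "esum B (Suc T) x y = killed B 0 x y + (\<Sum>t<T. killed B (Suc (Suc (2 * t))) x y)"
    by (simp add: esum_def sum.lessThan_Suc_shift del: sum.lessThan_Suc)
  also have "(\<Sum>t<T. killed B (Suc (Suc (2 * t))) x y)
      = of_bool (x \<in> B) * avg (\<lambda>z. of_bool (z \<in> B) * avg (\<lambda>w. esum B T w y) z) x"
    unfolding killed.simps(2) esum_def sum_distrib_left[symmetric] avg_sum[symmetric] ..
  finally show ?thesis
    by simp
qed

text \<open>One step is peeled off at each end, which reads as one simultaneous step of two walks.
  By \<open>avg_avg_eq\<close>, the term \<open>1 / deg adj y\<close> is the chance that walks at
  the same vertex choose the same edge.\<close>

lemma esum_Suc_both:
  "esum B (Suc T) x y = of_bool (x = y \<and> x \<in> B) / deg adj y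
     + of_bool (x \<in> B \<and> y \<in> B) * avg (\<lambda>z. avg (esum B T z) y) x"
proof -
  have k: "killed B (Suc (Suc n)) x y = of_bool (x \<in> B \<and> y \<in> B) * avg (\<lambda>z. avg (killed B n z) y) x" for n
    by (subst killed.simps(2)) (simp only: killed_last_step avg_cmult of_bool_conj mult.assoc)
  have "esum B (Suc T) x y = killed B 0 x y + (\<Sum>t<T. killed B (Suc (Suc (2 * t))) x y)"
    by (simp add: esum_def sum.lessThan_Suc_shift del: sum.lessThan_Suc)
  also have "(\<Sum>t<T. killed B (Suc (Suc (2 * t))) x y)
      = of_bool (x \<in> B \<and> y \<in> B) * avg (\<lambda>z. avg (esum B T z) y) x"
    unfolding k esum_def sum_distrib_left[symmetric] by (simp add: avg_sum)
  finally show ?thesis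
    by simp
qed

lemma esum_le_gsum: "esum B T x y \<le> gsum B (2 * T) x y"
proof (induction T)
  case (Suc T)
  then show ?case
    using killed_nonneg[of B "Suc (2 * T)" x y]
    by (simp add: esum_def gsum_def del: killed.simps)
qed simp

section \<open>Maximum principles and gradient bounds\<close>

lemma gsum_max:
  assumes "x \<in> V" shows "gsum B T x a \<le> gsum B T a a"
  using assms
proof (induction T arbitrary: x)
  case (Suc T)
  show ?case
  proof (cases "x = a \<or> x \<notin> B")
    case True
    then show ?thesis
      by (auto simp: gsum_outside gsum_nonneg)
  next
    case False
    \<comment> \<open>Away from \<open>a\<close> there is no source term, so the value is an average
      of values with the shorter horizon.\<close>
    then have "gsum B (Suc T) x a \<le> gsum B T a a"
      using Suc nbrs_in_V by (auto simp: gsum_Suc intro!: avg_le)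
    also have "\<dots> \<le> gsum B (Suc T) a a"
      by (rule gsum_mono) simp
    finally show ?thesis .
  qed
qed simp

lemma killed_avg_le:
  assumes "z \<in> V" "0 \<le> c" "\<And>w. w \<in> V \<Longrightarrow> f w \<le> c"
  shows "of_bool (z \<in> B) * avg f z \<le> c"
  using assms nbrs_in_V avg_le[of z f c] by auto

lemma esum_max:
  assumes "x \<in> V" shows "esum B T x a \<le> esum B T a a"
  using assms
proof (induction T arbitrary: x)
  case (Suc T)
  show ?case
  proof (cases "x = a \<or> x \<notin> B")
    case True
    then show ?thesis
      by (auto simp: esum_outside esum_nonneg)
  next
    case False
    then have "esum B (Suc T) x a \<le> esum B T a a"
      using Suc nbrs_in_V esum_nonneg
      by (simp add: esum_Suc) (intro avg_le killed_avg_le; auto)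
    also have "\<dots> \<le> esum B (Suc T) a a"
      by (rule esum_mono) simp
    finally show ?thesis .
  qed
qed simp

text \<open>The even times give \<open>esum\<close>; the odd times give its killed average around
  \<open>a\<close>, which \<open>esum_max\<close> bounds by \<open>esum\<close> at
  \<open>a\<close>.\<close>

lemma gsum_double_le:
  assumes "a \<in> V" shows "gsum B (2 * T) a a \<le> 2 * esum B T a a"
proof -
  have split: "gsum B (2 * T) a a = esum B T a a + (\<Sum>t<T. killed B (Suc (2 * t)) a a)"
    by (induction T) (simp_all add: gsum_def esum_def del: killed.simps)
  have "(\<Sum>t<T. killed B (Suc (2 * t)) a a) = of_bool (a \<in> B) * avg (\<lambda>z. esum B T z a) a"
    by (simp add: esum_def avg_sum sum_distrib_left)
  also have "\<dots> \<le> esum B T a a"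
    using assms by (intro killed_avg_le esum_max esum_nonneg)
  finally show ?thesis
    using split by simp
qed

text \<open>The deficit \<open>gsum B T a a - gsum B T x a\<close> is nonnegative by
  \<open>gsum_max\<close>. For \<open>x\<close> in \<open>B\<close> its average around
  \<open>x\<close> exceeds its value at \<open>x\<close> by at most the source term
  \<open>1 / deg adj a\<close>, which the 1 absorbs; \<open>le_deg_mult_avg\<close> then isolates
  one neighbour.\<close>

lemma gsum_neighbour:
  assumes "a \<in> V" "adj x z"
  shows "gsum B T a a - gsum B T z a \<le> deg adj x * (gsum B T a a - gsum B T x a + 1)"
proof -
  have V: "x \<in> V" "z \<in> V"
    using adj_in_V assms by blast+
  have d: "deg adj x \<ge> 1"
    using deg_pos[OF V(1)] by simp
  show ?thesis
  proof (cases "x \<in> B")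
    case False
    \<comment> \<open>Outside \<open>B\<close> the kernel vanishes, so the deficit at
      \<open>x\<close> is already maximal.\<close>
    have "gsum B T a a - gsum B T z a \<le> 1 * (gsum B T a a - gsum B T x a + 1)"
      using False gsum_nonneg[of B T z a] by (simp add: gsum_outside)
    also have "\<dots> \<le> deg adj x * (gsum B T a a - gsum B T x a + 1)"
      using d gsum_max[OF V(1), of B T a] by (intro mult_right_mono) auto
    finally show ?thesis .
  next
    case True
    have "gsum B T a a - gsum B T z a \<le> deg adj x * avg (\<lambda>z. gsum B T a a - gsum B T z a) x"
      using assms(2) gsum_max nbrs_in_V
      by (intro le_deg_mult_avg[of x "\<lambda>z. gsum B T a a - gsum B T z a"]) (auto simp: mem_nbrs)
    also have "avg (\<lambda>z. gsum B T a a - gsum B T z a) x \<le> gsum B T a a - gsum B T x a + 1"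
    proof -
      have "1 / deg adj a \<le> (1::real)"
        using deg_pos[OF assms(1)] by simp
      moreover have "gsum B T x a \<le> gsum B (Suc T) x a"
        by (rule gsum_mono) simp
      ultimately show ?thesis
        using True by (cases "x = a") (auto simp: avg_diff avg_const V(1) assms(1) gsum_Suc[of B T _ a])
    qed
    finally show ?thesis
      by (simp add: mult_left_mono)
  qed
qed

text \<open>The kernel is sampled at even times, so two edges are handled at once. With
  \<open>h z\<close> as the deficit of the killed average at the midpoint, each edge follows the
  pattern of \<open>gsum_neighbour\<close>.\<close>

lemma esum_second_neighbour:
  assumes "a \<in> V" "adj x z" "adj z w"
  shows "esum B T a a - esum B T w a
    \<le> deg adj x * deg adj z * (esum B T a a - esum B T x a + 1)"
proof -
  have V: "x \<in> V" "z \<in> V" "w \<in> V"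
    using adj_in_V assms by blast+
  have d: "real (deg adj x) \<ge> 1" "real (deg adj z) \<ge> 1"
    using deg_pos[OF V(1)] deg_pos[OF V(2)] by simp_all
  let ?D = "esum B T a a - esum B T x a + 1"
  define h where "h = (\<lambda>z. esum B T a a - of_bool (z \<in> B) * avg (\<lambda>w. esum B T w a) z)"
  have D: "0 \<le> ?D" and h: "0 \<le> h y" if "y \<in> V" for y
    using esum_max[OF V(1), of B T a] killed_avg_le[of y "esum B T a a" "\<lambda>w. esum B T w a" B]
      esum_max esum_nonneg that by (auto simp: h_def)
  show ?thesis
  proof (cases "x \<in> B")
    case False
    have "esum B T a a - esum B T w a \<le> 1 * ?D"
      using False esum_nonneg[of B T w a] by (simp add: esum_outside)
    also have "\<dots> \<le> deg adj x * deg adj z * ?D"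
      using d D[OF V(1)] by (intro mult_right_mono) (simp_all add: mult_ge1_I)
    finally show ?thesis .
  next
    case True
    have "h z \<le> deg adj x * avg h x"
      using assms(2) h nbrs_in_V by (intro le_deg_mult_avg) (auto simp: mem_nbrs)
    also have "avg h x \<le> ?D"
    proof -
      have "1 / deg adj a \<le> (1::real)"
        using deg_pos[OF assms(1)] by simp
      moreover have "esum B T x a \<le> esum B (Suc T) x a"
        by (rule esum_mono) simp
      ultimately show ?thesis
        using True by (cases "x = a") (auto simp: h_def avg_diff avg_const V(1) assms(1) esum_Suc[of B T _ a])
    qed
    finally have hz: "h z \<le> deg adj x * ?D"
      by (simp add: mult_left_mono)
    have "esum B T a a - esum B T w a \<le> deg adj z * h z"
    proof (cases "z \<in> B")
      case True
      have "esum B T a a - esum B T w a \<le> deg adj z * avg (\<lambda>w. esum B T a a - esum B T w a) z"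
        using assms(3) esum_max nbrs_in_V
        by (intro le_deg_mult_avg[of z "\<lambda>w. esum B T a a - esum B T w a"]) (auto simp: mem_nbrs)
      then show ?thesis
        using True by (simp add: h_def avg_diff avg_const[OF V(2)])
    next
      case False
      have "esum B T a a - esum B T w a \<le> 1 * h z"
        using False esum_nonneg[of B T w a] by (simp add: h_def)
      also have "\<dots> \<le> deg adj z * h z"
        using d h[OF V(2)] by (intro mult_right_mono) auto
      finally show ?thesis .
    qed
    also have "\<dots> \<le> deg adj z * (deg adj x * ?D)"
      using hz by (intro mult_left_mono) auto
    finally show ?thesis
      by (simp add: mult_ac)
  qed
qed

text \<open>\<open>gsum_neighbour\<close> is iterated along one path. Only degrees on that path
  enter \<open>K\<close>, hence its independence of \<open>B\<close> and \<open>T\<close>.\<close>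

lemma gsum_gradient:
  assumes "a \<in> V" "adj\<^sup>*\<^sup>* a b"
  shows "\<exists>K\<ge>0. \<forall>B T. gsum B T a a \<le> gsum B T b a + K"
  using assms(2)
proof (induction rule: rtranclp_induct)
  case (step x z)
  then obtain K where K: "K \<ge> 0" "\<And>B T. gsum B T a a \<le> gsum B T x a + K"
    by auto
  have "gsum B T a a \<le> gsum B T z a + deg adj x * (K + 1)" for B T
  proof -
    have "deg adj x * (gsum B T a a - gsum B T x a + 1) \<le> deg adj x * (K + 1)"
      using K(2)[of B T] by (intro mult_left_mono) auto
    then show ?thesis
      using gsum_neighbour[OF assms(1) step(2), of B T] by simp
  qed
  then show ?case
    using K(1) by (intro exI[of _ "deg adj x * (K + 1)"]) auto
qed (auto intro!: exI[of _ 0])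

text \<open>Parity matters because \<open>esum\<close>, summing over even times, vanishes when no
  path of even length joins its endpoints.\<close>

abbreviation even_connected :: "'a \<Rightarrow> 'a \<Rightarrow> bool" where
  "even_connected \<equiv> (adj OO adj)\<^sup>*\<^sup>*"

lemma esum_gradient:
  assumes "a \<in> V" "even_connected a b"
  shows "\<exists>K\<ge>0. \<forall>B T. esum B T a a \<le> esum B T b a + K"
  using assms(2)
proof (induction rule: rtranclp_induct)
  case (step x w)
  then obtain K where K: "K \<ge> 0" "\<And>B T. esum B T a a \<le> esum B T x a + K"
    by auto
  obtain z where z: "adj x z" "adj z w"
    using step(2) by auto
  have "esum B T a a \<le> esum B T w a + deg adj x * deg adj z * (K + 1)" for B T
  proof -
    have "deg adj x * deg adj z * (esum B T a a - esum B T x a + 1) \<le> deg adj x * deg adj z * (K + 1)"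
      using K(2)[of B T] by (intro mult_left_mono) auto
    then show ?thesis
      using esum_second_neighbour[OF assms(1) z, of B T] by simp
  qed
  then show ?case
    using K(1) by (intro exI[of _ "deg adj x * deg adj z * (K + 1)"]) auto
qed (auto intro!: exI[of _ 0])

text \<open>Moving both endpoints adds two edges. In the inductive step the hypothesis is applied
  with the midpoint \<open>m\<close> as the new endpoint, after which \<open>m\<close>,
  \<open>z\<close>, \<open>b'\<close> is one more double step.\<close>

lemma even_connected_step:
  assumes "even_connected a b" "adj a a'" "adj b b'"
  shows "even_connected a' b'"
  using assms(1,3)
proof (induction arbitrary: b' rule: rtranclp_induct)
  case base
  then show ?case
    using adj_sym[OF assms(2)] by (auto intro!: r_into_rtranclp)
next
  case (step y z)
  then obtain m where "adj y m" "adj m z"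
    by auto
  with step show ?case
    by (meson relcompp.relcompI rtranclp.rtrancl_into_rtrancl)
qed

section \<open>The probability of not colliding\<close>

text \<open>The probability that the walks cross no common edge at times \<open>t < T\<close>
  (lemma \<open>emeasure_no_coll\<close>).\<close>

primrec no_coll :: "nat \<Rightarrow> 'a \<Rightarrow> 'a \<Rightarrow> real" where
  "no_coll 0 a b = 1"
| "no_coll (Suc T) a b = avg (\<lambda>a'. avg (\<lambda>b'. of_bool (\<not> (a = b \<and> a' = b')) * no_coll T a' b') b) a"

lemma no_coll_nonneg: "0 \<le> no_coll T a b"
  by (induction T arbitrary: a b) (auto intro!: avg_nonneg)

lemma no_coll_le_1: "a \<in> V \<Longrightarrow> b \<in> V \<Longrightarrow> no_coll T a b \<le> 1"
proof (induction T arbitrary: a b)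
  case (Suc T)
  show ?case
    unfolding no_coll.simps using Suc nbrs_in_V by (intro avg_le) auto
qed simp

lemma no_coll_decreasing: "a \<in> V \<Longrightarrow> b \<in> V \<Longrightarrow> no_coll (Suc T) a b \<le> no_coll T a b"
proof (induction T arbitrary: a b)
  case 0
  show ?case
    using no_coll_le_1[OF 0, of "Suc 0"] by simp
next
  case (Suc T)
  show ?case
    unfolding no_coll.simps(2)[of "Suc T" a b] no_coll.simps(2)[of T a b]
    using Suc nbrs_in_V by (intro avg_mono mult_left_mono) auto
qed

lemma avg_avg_eq:
  assumes "a \<in> V"
  shows "avg (\<lambda>a'. avg (\<lambda>b'. of_bool (a' = b')) a) a = 1 / deg adj a"
proof -
  have "avg (\<lambda>a'. avg (\<lambda>b'. of_bool (a' = b')) a) a = avg (\<lambda>a'. 1 / deg adj a) a"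
    by (intro avg_cong) (simp add: avg_def of_bool_def)
  then show ?thesis
    using assms by (simp add: avg_const)
qed

text \<open>Decomposition at the first crossing, carried out by induction on \<open>T\<close>: that
  crossing counts once, and at most \<open>M\<close> more are expected from the common vertex
  reached.\<close>

lemma esum_le_coll:
  assumes "\<And>y. y \<in> V \<Longrightarrow> esum B T y y \<le> M" "0 \<le> M" "a \<in> V" "b \<in> V"
  shows "esum B T a b \<le> (1 + M) * (1 - no_coll T a b)"
  using assms
proof (induction T arbitrary: a b)
  case (Suc T)
  have le: "esum B T y y \<le> M" if "y \<in> V" for y
    using esum_mono[of T "Suc T" B y y] Suc.prems(1)[OF that] by simp
  have IH: "esum B T a' b' \<le> (1 + M) * (1 - no_coll T a' b')" if "a' \<in> V" "b' \<in> V" for a' b'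
    using Suc.IH[OF le Suc.prems(2) that] .
  have rhs: "(1 + M) * (1 - no_coll (Suc T) a b) =
      avg (\<lambda>a'. avg (\<lambda>b'. (1 + M) * (1 - of_bool (\<not> (a = b \<and> a' = b')) * no_coll T a' b')) b) a"
    using Suc.prems(3,4) by (simp add: avg_cmult avg_diff avg_const)
  show ?case
  proof (cases "a \<in> B \<and> b \<in> B")
    case False
    then show ?thesis
      using Suc.prems no_coll_le_1[of a b "Suc T"] by (auto simp: esum_Suc_both)
  next
    case True
    have "esum B (Suc T) a b = avg (\<lambda>a'. avg (\<lambda>b'. of_bool (a = b) * of_bool (a' = b') + esum B T a' b') b) a"
      using True Suc.prems(3) by (auto simp: esum_Suc_both avg_add avg_cmult avg_avg_eq)
    also have "\<dots> \<le> (1 + M) * (1 - no_coll (Suc T) a b)"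
      unfolding rhs
    proof (intro avg_mono)
      fix a' b' assume "a' \<in> nbrs adj a" "b' \<in> nbrs adj b"
      then have "a' \<in> V" "b' \<in> V"
        using nbrs_in_V by auto
      \<comment> \<open>On a crossing this compares \<open>1 + esum B T a' a'\<close> with
        \<open>1 + M\<close>; otherwise it is the induction hypothesis.\<close>
      then show "of_bool (a = b) * of_bool (a' = b') + esum B T a' b'
          \<le> (1 + M) * (1 - of_bool (\<not> (a = b \<and> a' = b')) * no_coll T a' b')"
        using IH le by (cases "a = b \<and> a' = b'") auto
    qed
    finally show ?thesis .
  qed
qed simp

section \<open>Recurrence, exhaustion and the crossing probability\<close>

text \<open>The probability that the walk from \<open>x\<close> visits \<open>a\<close> at some time \<open>t < T\<close>
  (lemma \<open>emeasure_srw_hit\<close>).\<close>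

primrec hit :: "'a \<Rightarrow> nat \<Rightarrow> 'a \<Rightarrow> real" where
  "hit a 0 x = 0"
| "hit a (Suc T) x = (if x = a then 1 else avg (hit a T) x)"

text \<open>First visit decomposition: after a visit to \<open>a\<close> before time
  \<open>T\<close>, the next \<open>N\<close> times still lie within the horizon
  \<open>T + N\<close>.\<close>

lemma hit_mult_gsum_le:
  assumes "a \<in> V" "x \<in> V"
  shows "hit a T x * gsum V N a a \<le> gsum V (T + N) x a"
  using assms(2)
proof (induction T arbitrary: x)
  case 0
  then show ?case
    by (simp add: gsum_nonneg)
next
  case (Suc T)
  show ?case
  proof (cases "x = a")
    case True
    then show ?thesis
      using gsum_mono[of N "Suc (T + N)" V a a] by simp
  next
    case False
    have "hit a (Suc T) x * gsum V N a a = avg (\<lambda>z. gsum V N a a * hit a T z) x"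
      using False by (simp add: avg_cmult)
    also have "\<dots> \<le> avg (\<lambda>z. gsum V (T + N) z a) x"
      using Suc.IH nbrs_in_V by (intro avg_mono) (simp add: mult.commute)
    also have "\<dots> = gsum V (Suc T + N) x a"
      using False Suc.prems by (simp add: gsum_Suc)
    finally show ?thesis .
  qed
qed

text \<open>Renewal argument: a finite limit \<open>L\<close> would satisfy
  \<open>L \<ge> 1 / deg adj a + L\<close>, by letting first \<open>T\<close> and then
  \<open>N\<close> tend to infinity.\<close>

lemma gsum_unbounded:
  assumes "a \<in> V" and "(\<lambda>T. avg (hit a T) a) \<longlonglongrightarrow> 1"
  shows "\<exists>T. gsum V T a a > M"
proof (rule ccontr)
  assume "\<not> ?thesis"
  then have "\<And>T. gsum V T a a \<le> M"
    by (auto simp: not_less)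
  then obtain L where L: "(\<lambda>T. gsum V T a a) \<longlonglongrightarrow> L" "\<And>T. gsum V T a a \<le> L"
    using incseq_convergent[of "\<lambda>T. gsum V T a a" M] gsum_mono by (auto simp: incseq_def)
  have "L \<ge> 1 / deg adj a + avg (hit a T) a * gsum V N a a" for T N
  proof -
    have "avg (hit a T) a * gsum V N a a = avg (\<lambda>z. gsum V N a a * hit a T z) a"
      by (simp add: avg_cmult)
    also have "\<dots> \<le> avg (\<lambda>z. gsum V (T + N) z a) a"
      using hit_mult_gsum_le[OF assms(1)] nbrs_in_V by (intro avg_mono) (simp add: mult.commute)
    finally show ?thesis
      using L(2)[of "Suc (T + N)"] assms(1) by (simp add: gsum_Suc)
  qed
  then have "L \<ge> 1 / deg adj a + 1 * gsum V N a a" for N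
    by (intro LIMSEQ_le_const2[OF tendsto_add[OF tendsto_const tendsto_mult[OF assms(2) tendsto_const]]]) auto
  then have "L \<ge> 1 / deg adj a + L"
    by (intro LIMSEQ_le_const2[OF tendsto_add[OF tendsto_const L(1)]]) auto
  then show False
    using deg_pos[OF assms(1)] by simp
qed

text \<open>In \<open>t\<close> steps the walk sees only finitely many vertices, and all of them
  eventually lie in \<open>B r\<close>.\<close>

lemma eventually_killed_eq:
  assumes "incseq B" "(\<Union>r. B r) = V" "x \<in> V"
  shows "\<forall>\<^sub>F r in sequentially. killed (B r) t x y = killed V t x y"
proof -
  have ev: "\<forall>\<^sub>F r in sequentially. x \<in> B r" if "x \<in> V" for x
  proof -
    from that obtain n where "x \<in> B n"
      using assms(2) by auto
    then show ?thesis
      using assms(1) by (auto simp: eventually_sequentially incseq_def)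
  qed
  show ?thesis
    using assms(3)
  proof (induction t arbitrary: x)
    case 0
    show ?case
      using ev[OF 0] by eventually_elim (simp add: 0)
  next
    case (Suc t)
    have "\<forall>\<^sub>F r in sequentially. x \<in> B r"
      by (rule ev[OF Suc.prems])
    moreover have "\<forall>\<^sub>F r in sequentially. \<forall>z\<in>nbrs adj x. killed (B r) t z y = killed V t z y"
      using Suc.IH nbrs_in_V by (intro eventually_ball_finite) auto
    ultimately show ?case
      by eventually_elim (auto simp: Suc.prems intro: avg_cong)
  qed
qed

lemma eventually_gsum_eq:
  assumes "incseq B" "(\<Union>r. B r) = V" "x \<in> V"
  shows "\<forall>\<^sub>F r in sequentially. gsum (B r) T x y = gsum V T x y"
proof -
  have "\<forall>\<^sub>F r in sequentially. \<forall>t\<in>{..<T}. killed (B r) t x y = killed V t x y"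
    using eventually_killed_eq[OF assms] by (intro eventually_ball_finite) auto
  then show ?thesis
    by eventually_elim (simp add: gsum_def)
qed

lemma no_coll_uniform_bound:
  assumes "connected_graph V adj" "incseq B" "(\<Union>r. B r) = V" "z \<in> V"
    and rec: "(\<lambda>T. avg (hit z T) z) \<longlonglongrightarrow> 1"
    and "0 \<le> C"
    and G: "\<And>r. (\<lambda>T. gsum (B r) T z z) \<longlonglongrightarrow> G r"
    and bound: "\<And>r T x. x \<in> B r \<Longrightarrow> gsum (B r) T x x \<le> C * G r"
    and "a \<in> V" "b \<in> V" "even_connected a b"
  shows "\<exists>T. no_coll T a b \<le> 1 - 1 / (8 * (1 + C))"
proof -
  obtain K1 where K1: "K1 \<ge> 0" "\<And>B T. esum B T a a \<le> esum B T b a + K1"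
    using esum_gradient[OF assms(9,11)] by auto
  have "adj\<^sup>*\<^sup>* z a"
    using assms(1,4,9) by (auto simp: connected_graph_def)
  from gsum_gradient[OF assms(4) this]
  obtain K2 where K2: "K2 \<ge> 0" "\<And>B T. gsum B T z z \<le> gsum B T a z + K2"
    by auto
  define K where "K = K1 + K2"
  \<comment> \<open>The chain gives g(z,z) \<le> 2 s(a,b) + 2 \<open>K1\<close> + \<open>K2\<close>,
    so \<open>K1 + K2\<close> suffices after halving.\<close>
  have low: "gsum B (2 * T) z z / 2 - K \<le> esum B T a b" for B T
  proof -
    have "gsum B (2 * T) z z \<le> gsum B (2 * T) z a + K2"
      using K2(2)[of B "2 * T"] gsum_sym[of B "2 * T" a z] by simp
    also have "gsum B (2 * T) z a \<le> gsum B (2 * T) a a"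
      by (rule gsum_max[OF assms(4)])
    also have "\<dots> \<le> 2 * esum B T a a"
      by (rule gsum_double_le[OF assms(9)])
    finally show ?thesis
      using K1(2)[of B T] K1(1) K2(1) esum_sym[of B T a b] by (simp add: K_def)
  qed
  \<comment> \<open>\<open>G r > 8 * K\<close> lets an eighth of \<open>G r\<close> absorb
    \<open>K\<close>; \<open>G r > 1\<close> later gives
    \<open>1 + C * G r \<le> (1 + C) * G r\<close>.\<close>
  define M where "M = 8 * K + 1"
  obtain S where S: "gsum V S z z > M"
    using gsum_unbounded[OF assms(4) rec] by blast
  obtain r where r: "gsum (B r) S z z = gsum V S z z"
    using eventually_gsum_eq[OF assms(2-4), of S z] by (auto simp: eventually_sequentially)
  have le_G: "gsum (B r) T z z \<le> G r" for T
    using G[of r] gsum_mono by (intro incseq_le) (auto simp: incseq_def)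
  have GM: "G r > M"
    using S r le_G[of S] by simp
  have M1: "M \<ge> 1"
    using K1 K2 by (simp add: M_def K_def)
  \<comment> \<open>Half of the limit is reached at some even horizon \<open>2 * T\<close>, as
    \<open>low\<close> requires.\<close>
  have "\<forall>\<^sub>F T in sequentially. gsum (B r) T z z > G r / 2"
    using GM M1 by (intro order_tendstoD[OF G[of r]]) auto
  then obtain T where T: "gsum (B r) (2 * T) z z > G r / 2"
    using mult_le_mono1[of 1 2] by (auto simp: eventually_sequentially) (metis le_add1 mult_2)
  have "G r / 8 \<le> G r / 4 - K"
    using GM by (simp add: M_def)
  also have "\<dots> \<le> esum (B r) T a b"
    using low[of "B r" T] T by simp
  also have "\<dots> \<le> (1 + C * G r) * (1 - no_coll T a b)"
  proof (rule esum_le_coll)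
    show "esum (B r) T y y \<le> C * G r" if "y \<in> V" for y
      using esum_le_gsum[of "B r" T y y] bound[of y r "2 * T"] GM M1 \<open>0 \<le> C\<close>
      by (cases "y \<in> B r") (auto simp: esum_outside)
    show "0 \<le> C * G r"
      using GM M1 \<open>0 \<le> C\<close> by simp
  qed (use assms in auto)
  also have "\<dots> \<le> ((1 + C) * G r) * (1 - no_coll T a b)"
    using GM M1 no_coll_le_1[OF assms(9,10)] by (intro mult_right_mono) (auto simp: algebra_simps)
  finally have "G r * (1 / 8) \<le> G r * ((1 + C) * (1 - no_coll T a b))"
    by (simp add: mult_ac)
  then have "1 / 8 \<le> (1 + C) * (1 - no_coll T a b)"
    using GM M1 by (simp only: mult_le_cancel_left)
  then show ?thesis
    using \<open>0 \<le> C\<close> by (intro exI[of _ T]) (simp add: field_simps)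
qed

text \<open>The horizon \<open>T\<close> in the hypothesis depends on the pair and cannot be chosen
  uniformly. The limit \<open>U\<close> avoids this: it satisfies the one-step equation, with the
  same \<open>c\<close> at every pair.\<close>

lemma no_coll_tendsto_0:
  assumes "0 < c"
    and c: "\<And>a b. a \<in> V \<Longrightarrow> b \<in> V \<Longrightarrow> even_connected a b \<Longrightarrow> \<exists>T. no_coll T a b \<le> 1 - c"
    and ab: "a \<in> V" "b \<in> V" "even_connected a b"
  shows "(\<lambda>T. no_coll T a b) \<longlonglongrightarrow> 0"
proof -
  define U where "U a b = lim (\<lambda>T. no_coll T a b)" for a b
  have dec: "decseq (\<lambda>T. no_coll T a b)" if "a \<in> V" "b \<in> V" for a b
    using no_coll_decreasing[OF that] by (simp add: decseq_Suc_iff)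
  have U: "(\<lambda>T. no_coll T a b) \<longlonglongrightarrow> U a b" if "a \<in> V" "b \<in> V" for a b
  proof -
    have "convergent (\<lambda>T. no_coll T a b)"
      using decseq_convergent[OF dec[OF that], of 0] no_coll_nonneg by (metis convergentI)
    then show ?thesis
      by (simp add: U_def convergent_LIMSEQ_iff)
  qed
  have rec: "U a b = avg (\<lambda>a'. avg (\<lambda>b'. of_bool (\<not> (a = b \<and> a' = b')) * U a' b') b) a"
    if "a \<in> V" "b \<in> V" for a b
  proof (rule LIMSEQ_unique)
    show "(\<lambda>T. no_coll (Suc T) a b) \<longlonglongrightarrow> U a b"
      using U[OF that] by (rule LIMSEQ_Suc)
    show "(\<lambda>T. no_coll (Suc T) a b)
        \<longlonglongrightarrow> avg (\<lambda>a'. avg (\<lambda>b'. of_bool (\<not> (a = b \<and> a' = b')) * U a' b') b) a"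
      unfolding no_coll.simps using nbrs_in_V by (intro tendsto_avg tendsto_mult tendsto_const U)
  qed
  \<comment> \<open>Induction on \<open>n\<close> spreads the bound for \<open>n = 0\<close> through
    the one-step equation; \<open>n\<close> tending to infinity then gives
    \<open>U \<le> (1 - c) U\<close>.\<close>
  have le: "U a b \<le> (1 - c) * no_coll n a b" if "a \<in> V" "b \<in> V" "even_connected a b" for n a b
    using that
  proof (induction n arbitrary: a b)
    case 0
    then obtain T where "no_coll T a b \<le> 1 - c"
      using c by blast
    moreover have "U a b \<le> no_coll T a b"
      using decseq_ge[OF dec U] 0 by blast
    ultimately show ?case
      by simp
  next
    case (Suc n)
    have "U a b \<le> avg (\<lambda>a'. avg (\<lambda>b'. of_bool (\<not> (a = b \<and> a' = b')) * ((1 - c) * no_coll n a' b')) b) a"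
      unfolding rec[OF Suc.prems(1,2)]
      using Suc.IH nbrs_in_V even_connected_step[OF Suc.prems(3)]
      by (intro avg_mono mult_left_mono) (auto simp: mem_nbrs)
    also have "\<dots> = (1 - c) * no_coll (Suc n) a b"
      by (simp add: avg_cmult[symmetric] mult.left_commute)
    finally show ?case .
  qed
  have "U a b \<le> (1 - c) * U a b"
    using le[OF ab] by (intro LIMSEQ_le_const[OF tendsto_mult[OF tendsto_const U[OF ab(1,2)]]]) auto
  then have "c * U a b \<le> 0"
    by (simp add: algebra_simps)
  moreover have "U a b \<ge> 0"
    using no_coll_nonneg by (intro LIMSEQ_le_const[OF U[OF ab(1,2)]]) auto
  ultimately have "U a b = 0"
    using \<open>0 < c\<close> by (simp add: mult_le_0_iff)
  then show ?thesis
    using U[OF ab(1,2)] by simp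
qed

end

section \<open>The Markov property of the walk\<close>

text \<open>Law of the first \<open>n + 1\<close> positions, built from the first step. It bridges
  the cylinder formula for \<open>srw\<close> and the Markov property.\<close>

primrec path_pmf :: "('a \<Rightarrow> 'a \<Rightarrow> bool) \<Rightarrow> nat \<Rightarrow> 'a \<Rightarrow> 'a list pmf" where
  "path_pmf adj 0 a = return_pmf [a]"
| "path_pmf adj (Suc n) a = bind_pmf (pmf_of_set (nbrs adj a)) (\<lambda>y. map_pmf (Cons a) (path_pmf adj n y))"

lemma length_path_pmf: "l \<in> set_pmf (path_pmf adj n a) \<Longrightarrow> length l = Suc n"
  by (induction n arbitrary: a l) auto

lemma pmf_path_pmf_Cons:
  "ennreal (pmf (path_pmf adj (Suc n) a) (x # l)) =
     of_bool (x = a) * (\<integral>\<^sup>+y. pmf (path_pmf adj n y) l \<partial>pmf_of_set (nbrs adj a))"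
proof -
  have "pmf (map_pmf (Cons a) p) (x # l) = of_bool (x = a) * pmf p l" for p
    by (cases "x = a") (auto simp: pmf_map_inj' pmf_eq_0_set_pmf)
  then show ?thesis
    by (cases "x = a") (simp_all add: ennreal_pmf_bind)
qed

lemma pmf_path_pmf:
  "ennreal (pmf (path_pmf adj n a) (map p [0..<Suc n])) =
     of_bool (p 0 = a) * (\<Prod>i<n. ennreal (pmf (pmf_of_set (nbrs adj (p i))) (p (Suc i))))"
proof (induction n arbitrary: a p)
  case 0
  then show ?case
    by (simp add: pmf_return eq_commute)
next
  case (Suc n)
  have "map p [0..<Suc (Suc n)] = p 0 # map (\<lambda>i. p (Suc i)) [0..<Suc n]"
    by (simp add: map_Suc_upt[symmetric] upt_conv_Cons del: upt_Suc)
  then have "ennreal (pmf (path_pmf adj (Suc n) a) (map p [0..<Suc (Suc n)])) =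
      of_bool (p 0 = a) * (\<integral>\<^sup>+y. of_bool (p 1 = y) *
        (\<Prod>i<n. ennreal (pmf (pmf_of_set (nbrs adj (p (Suc i)))) (p (Suc (Suc i))))) \<partial>pmf_of_set (nbrs adj a))"
    by (simp only: pmf_path_pmf_Cons Suc) simp
  also have "(\<lambda>y. of_bool (p 1 = y) :: ennreal) = indicator {p 1}"
    by (auto simp: indicator_def)
  also have "of_bool (p 0 = a) * (\<integral>\<^sup>+y. indicator {p 1} y *
        (\<Prod>i<n. ennreal (pmf (pmf_of_set (nbrs adj (p (Suc i)))) (p (Suc (Suc i))))) \<partial>pmf_of_set (nbrs adj a))
      = of_bool (p 0 = a) * (ennreal (pmf (pmf_of_set (nbrs adj a)) (p 1)) *
        (\<Prod>i<n. ennreal (pmf (pmf_of_set (nbrs adj (p (Suc i)))) (p (Suc (Suc i))))))"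
    by (subst nn_integral_multc) (simp_all add: emeasure_pmf_single)
  finally show ?case
    by (cases "p 0 = a") (simp_all add: prod.lessThan_Suc_shift del: prod.lessThan_Suc)
qed

lemma measurable_coordinate_mem [measurable]:
  "(\<lambda>X. X i \<in> A) \<in> PiM UNIV (\<lambda>_. count_space UNIV) \<rightarrow>\<^sub>M count_space UNIV"
  by (rule measurable_compose[OF measurable_component_singleton[of i UNIV]]) auto

lemma measurable_coordinate_eq [measurable]:
  "(\<lambda>X. X i = v) \<in> PiM UNIV (\<lambda>_. count_space UNIV) \<rightarrow>\<^sub>M count_space UNIV"
  by (rule measurable_compose[OF measurable_component_singleton[of i UNIV]]) auto

lemma sets_srw_coordinates:
  fixes A :: "nat \<Rightarrow> 'a set"
  shows "{X. \<forall>i\<le>n. X i \<in> A i} \<in> sets (PiM UNIV (\<lambda>_::nat. count_space (UNIV::'a set)))"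
proof -
  have "{X \<in> space (PiM UNIV (\<lambda>_::nat. count_space (UNIV::'a set))). \<forall>i\<in>{..n}. X i \<in> A i}
      \<in> sets (PiM UNIV (\<lambda>_::nat. count_space (UNIV::'a set)))"
    by measurable
  then show ?thesis
    by (simp add: space_PiM Ball_def)
qed

text \<open>\<open>L\<close> may be uncountable, so only its part in the countable support of
  \<open>path_pmf\<close> is split into cylinders, which yields one inequality.\<close>

lemma emeasure_path_pmf_le:
  assumes "{X. map X [0..<Suc n] \<in> L} \<in> sets (srw adj a)"
  shows "emeasure (path_pmf adj n a) L \<le> emeasure (srw adj a) {X. map X [0..<Suc n] \<in> L}"
proof -
  let ?S = "L \<inter> set_pmf (path_pmf adj n a)"
  let ?cyl = "\<lambda>l. {X. \<forall>i\<le>n. X i = l ! i}"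
  have cyl: "?cyl l \<in> sets (srw adj a)" for l :: "'a list"
    using sets_srw_coordinates[of n "\<lambda>i. {l ! i}"] by (simp add: sets_srw)
  have map_eq: "X \<in> ?cyl l \<longleftrightarrow> map X [0..<Suc n] = l" if "l \<in> ?S" for X :: "nat \<Rightarrow> 'a" and l
    using length_path_pmf[of l adj n a] that by (auto simp: list_eq_iff_nth_eq less_Suc_eq_le simp del: upt_Suc)
  have "emeasure (path_pmf adj n a) L = emeasure (path_pmf adj n a) ?S"
    by (metis emeasure_Int_set_pmf)
  also have "\<dots> = (\<integral>\<^sup>+l. pmf (path_pmf adj n a) l \<partial>count_space ?S)"
    by (simp add: nn_integral_pmf)
  also have "\<dots> = (\<integral>\<^sup>+l. emeasure (srw adj a) (?cyl l) \<partial>count_space ?S)"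
  proof (intro nn_integral_cong)
    fix l assume "l \<in> space (count_space ?S)"
    then have "map ((!) l) [0..<Suc n] = l"
      using length_path_pmf[of l adj n a] by (auto simp: list_eq_iff_nth_eq simp del: upt_Suc)
    then show "ennreal (pmf (path_pmf adj n a) l) = emeasure (srw adj a) (?cyl l)"
      using pmf_path_pmf[of adj n a "(!) l"] emeasure_srw_cylinder[of adj a n "(!) l"] by simp
  qed
  also have "\<dots> = emeasure (srw adj a) (\<Union>l\<in>?S. ?cyl l)"
    using map_eq by (intro emeasure_UN_countable[symmetric] cyl)
      (auto simp: disjoint_family_on_def intro: countable_subset[OF _ countable_set_pmf])
  also have "\<dots> \<le> emeasure (srw adj a) {X. map X [0..<Suc n] \<in> L}"
    using map_eq by (intro emeasure_mono assms) auto
  finally show ?thesis .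
qed

text \<open>Both measures are probabilities, so the inequality for \<open>L\<close> and for its
  complement is an equality.\<close>

lemma emeasure_srw_path:
  assumes "{X. map X [0..<Suc n] \<in> L} \<in> sets (srw adj a)"
  shows "emeasure (srw adj a) {X. map X [0..<Suc n] \<in> L} = emeasure (path_pmf adj n a) L"
proof -
  interpret prob_space "srw adj a"
    by (rule prob_space_srw)
  have compl: "{X. map X [0..<Suc n] \<in> - L} = space (srw adj a) - {X. map X [0..<Suc n] \<in> L}"
    by (auto simp: space_srw)
  have "{X. map X [0..<Suc n] \<in> - L} \<in> sets (srw adj a)"
    unfolding compl using assms by (rule sets.compl_sets)
  then have "emeasure (path_pmf adj n a) (- L) \<le> emeasure (srw adj a) {X. map X [0..<Suc n] \<in> - L}"
    by (rule emeasure_path_pmf_le)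
  then have "measure (path_pmf adj n a) (- L) \<le> prob (space (srw adj a) - {X. map X [0..<Suc n] \<in> L})"
    unfolding compl by (simp add: emeasure_eq_measure measure_pmf.emeasure_eq_measure)
  then have "prob {X. map X [0..<Suc n] \<in> L} \<le> measure (path_pmf adj n a) L"
    using prob_compl[OF assms] measure_pmf.prob_compl[of L "path_pmf adj n a"] by (simp add: Compl_eq_Diff_UNIV)
  then show ?thesis
    using emeasure_path_pmf_le[OF assms] by (simp add: emeasure_eq_measure measure_pmf.emeasure_eq_measure)
qed

lemma measurable_case_nat [measurable]:
  "case_nat (a::'a) \<in> srw adj b \<rightarrow>\<^sub>M PiM UNIV (\<lambda>_. count_space UNIV)"
proof -
  have "case_nat a \<in> PiM UNIV (\<lambda>_. count_space (UNIV :: 'a set)) \<rightarrow>\<^sub>M PiM UNIV (\<lambda>_. count_space UNIV)"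
  proof (rule measurable_PiM_single')
    show "(\<lambda>\<omega>. case_nat a \<omega> i) \<in> PiM UNIV (\<lambda>_. count_space (UNIV :: 'a set)) \<rightarrow>\<^sub>M count_space UNIV" for i
      by (cases i) simp_all
  qed auto
  then show ?thesis
    by (simp cong: measurable_cong_sets add: sets_srw)
qed

text \<open>Markov property at time 1. Both sides agree on sets depending on finitely many
  coordinates, where \<open>path_pmf\<close> computes them, and these determine the measure.\<close>

lemma srw_first_step:
  "srw adj a = measure_pmf (pmf_of_set (nbrs adj a))
     \<bind> (\<lambda>y. distr (srw adj y) (PiM UNIV (\<lambda>_. count_space UNIV)) (case_nat a))"
  (is "_ = ?R")
proof -
  let ?M = "PiM UNIV (\<lambda>_::nat. count_space (UNIV::'a set))"
  let ?K = "\<lambda>y. distr (srw adj y) ?M (case_nat a)"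
  have K: "?K \<in> measure_pmf (pmf_of_set (nbrs adj a)) \<rightarrow>\<^sub>M subprob_algebra ?M"
    by (auto simp: space_subprob_algebra intro!: prob_space_imp_subprob_space prob_space.prob_space_distr prob_space_srw)
  have setsR: "sets ?R = sets ?M"
    by (rule sets_bind) auto
  have R: "emeasure ?R S = (\<integral>\<^sup>+y. emeasure (srw adj y) {X. case_nat a X \<in> S} \<partial>pmf_of_set (nbrs adj a))"
    if "S \<in> sets ?M" for S
    using that by (subst emeasure_bind[OF _ K]) (auto simp: emeasure_distr space_srw vimage_def)
  show ?thesis
  proof (rule measure_eqI_PiM_infinite)
    fix A :: "nat \<Rightarrow> 'a set" and J assume J: "finite J" "J \<subseteq> UNIV" "\<And>i. i \<in> J \<Longrightarrow> A i \<in> sets (count_space UNIV)"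
    \<comment> \<open>The coordinates in \<open>J\<close> are padded to an initial segment ending at
      \<open>Suc n\<close>, so that at least one step can be split off.\<close>
    obtain n where n: "\<And>i. i \<in> J \<Longrightarrow> i \<le> Suc n"
      using J(1) finite_nat_set_iff_bounded_le by (metis le_SucI)
    define A' where "A' i = (if i \<in> J then A i else UNIV)" for i
    let ?S = "prod_emb UNIV (\<lambda>_. count_space UNIV) J (Pi\<^sub>E J A)"
    have S: "?S = {X. \<forall>i\<le>Suc n. X i \<in> A' i}"
      using n by (auto simp: prod_emb_def A'_def PiE_iff space_PiM)
    have Sm: "?S \<in> sets ?M"
      unfolding S by (rule sets_srw_coordinates)
    define L where "L = {l. \<forall>i\<le>Suc n. l ! i \<in> A' i}"
    have nth: "map X [0..<Suc m] ! i = X i" if "i \<le> m" for X :: "nat \<Rightarrow> 'a" and i m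
      using that by (simp add: less_Suc_eq_le del: upt_Suc)
    have SL: "?S = {X. map X [0..<Suc (Suc n)] \<in> L}"
      unfolding S L_def by (auto simp: nth simp del: upt_Suc)
    have shift: "map (case_nat a X) [0..<Suc (Suc n)] = a # map X [0..<Suc n]" for X
      by (subst upt_conv_Cons) (simp_all add: map_Suc_upt[symmetric] del: upt_Suc)
    have "emeasure (srw adj a) ?S = emeasure (path_pmf adj (Suc n) a) L"
      unfolding SL using Sm by (intro emeasure_srw_path) (simp add: SL sets_srw)
    also have "\<dots> = (\<integral>\<^sup>+y. emeasure (path_pmf adj n y) {l. a # l \<in> L} \<partial>pmf_of_set (nbrs adj a))"
      by (simp add: emeasure_bind_pmf vimage_def)
    also have "\<dots> = (\<integral>\<^sup>+y. emeasure (srw adj y) {X. case_nat a X \<in> ?S} \<partial>pmf_of_set (nbrs adj a))"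
    proof (intro nn_integral_cong)
      fix y
      have eq: "{X. case_nat a X \<in> ?S} = {X. map X [0..<Suc n] \<in> {l. a # l \<in> L}}"
        unfolding SL by (simp add: shift del: upt_Suc)
      have "{X. case_nat a X \<in> ?S} \<in> sets (srw adj y)"
        using measurable_sets[OF measurable_case_nat Sm, of a adj y] by (simp add: space_srw vimage_def)
      then show "emeasure (path_pmf adj n y) {l. a # l \<in> L} = emeasure (srw adj y) {X. case_nat a X \<in> ?S}"
        unfolding eq by (rule emeasure_srw_path[symmetric])
    qed
    finally show "emeasure (srw adj a) ?S = emeasure ?R ?S"
      by (simp only: R[OF Sm])
  next
    show "finite_measure (srw adj a)"
      using prob_space_srw by (rule prob_space.finite_measure)
  qed (simp_all add: sets_srw setsR)
qed

lemma nn_integral_srw_first_step: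
  assumes "f \<in> borel_measurable (PiM UNIV (\<lambda>_. count_space UNIV))"
  shows "(\<integral>\<^sup>+X. f X \<partial>srw adj a) = (\<integral>\<^sup>+y. (\<integral>\<^sup>+X. f (case_nat a X) \<partial>srw adj y) \<partial>pmf_of_set (nbrs adj a))"
proof -
  let ?M = "PiM UNIV (\<lambda>_::nat. count_space (UNIV::'a set))"
  have K: "(\<lambda>y. distr (srw adj y) ?M (case_nat a)) \<in> measure_pmf (pmf_of_set (nbrs adj a)) \<rightarrow>\<^sub>M subprob_algebra ?M"
    by (auto simp: space_subprob_algebra intro!: prob_space_imp_subprob_space prob_space.prob_space_distr prob_space_srw)
  show ?thesis
    by (subst srw_first_step, subst nn_integral_bind[OF assms K]) (simp add: nn_integral_distr assms)
qed

lemma emeasure_srw_first_step: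
  assumes "S \<in> sets (PiM UNIV (\<lambda>_. count_space UNIV))"
  shows "emeasure (srw adj a) S = (\<integral>\<^sup>+y. emeasure (srw adj y) {X. case_nat a X \<in> S} \<partial>pmf_of_set (nbrs adj a))"
proof -
  have "{X. case_nat a X \<in> S} \<in> sets (srw adj y)" for y
    using measurable_sets[OF measurable_case_nat assms, of a adj y] by (simp add: space_srw vimage_def)
  moreover have "indicator S (case_nat a X) = (indicator {X. case_nat a X \<in> S} X :: ennreal)" for X
    by (simp add: indicator_def)
  ultimately show ?thesis
    using nn_integral_srw_first_step[of "indicator S" adj a] assms by (simp add: sets_srw)
qed

lemma AE_srw_start: "AE X in srw adj a. X 0 = a"
proof -
  interpret prob_space "srw adj a"
    by (rule prob_space_srw)
  have "{X. X 0 = a} \<in> sets (srw adj a)"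
    using sets_srw_coordinates[of 0 "\<lambda>_. {a}"] by (simp add: sets_srw)
  moreover have "emeasure (srw adj a) {X. X 0 = a} = 1"
    using emeasure_srw_cylinder[of adj a 0 "\<lambda>_. a"] by simp
  ultimately show ?thesis
    using AE_in_set_eq_1[of "{X. X 0 = a}"] by (simp add: emeasure_eq_measure)
qed

text \<open>The series is the counting measure of an infinite set of times.\<close>

lemma suminf_of_bool_infinite:
  assumes "\<And>n. \<exists>t\<ge>n. P t"
  shows "(\<Sum>t. of_bool (P t) :: ennreal) = \<infinity>"
proof -
  have "infinite {t. P t}"
    using assms by (auto simp: infinite_nat_iff_unbounded_le)
  then have "emeasure (count_space UNIV) {t. P t} = \<infinity>"
    by simp
  then have "(\<integral>\<^sup>+t. indicator {t. P t} t \<partial>count_space UNIV) = \<infinity>"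
    by simp
  then show ?thesis
    by (simp add: nn_integral_count_space_nat indicator_def)
qed

section \<open>The recursions as probabilities of the walk\<close>

context graph_without_isolated_vertices
begin

lemma nn_integral_nbrs_sum:
  assumes "x \<in> V"
  shows "(\<integral>\<^sup>+y. f y \<partial>pmf_of_set (nbrs adj x)) = (\<Sum>y\<in>nbrs adj x. f y) / deg adj x"
  using nbrs_nonempty[OF assms] by (simp add: nn_integral_pmf_of_set deg_def)

lemma nn_integral_nbrs:
  assumes "x \<in> V" "\<And>y. y \<in> nbrs adj x \<Longrightarrow> f y = ennreal (g y)" "\<And>y. y \<in> nbrs adj x \<Longrightarrow> 0 \<le> g y"
  shows "(\<integral>\<^sup>+y. f y \<partial>pmf_of_set (nbrs adj x)) = ennreal (avg g x)"
proof -
  have "(\<integral>\<^sup>+y. f y \<partial>pmf_of_set (nbrs adj x)) = (\<Sum>y\<in>nbrs adj x. f y) / deg adj x"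
    by (rule nn_integral_nbrs_sum[OF assms(1)])
  also have "(\<Sum>y\<in>nbrs adj x. f y) = ennreal (\<Sum>y\<in>nbrs adj x. g y)"
    using assms by simp
  finally show ?thesis
    using assms deg_pos[OF assms(1)]
    by (simp add: avg_def divide_ennreal sum_nonneg ennreal_of_nat_eq_real_of_nat)
qed

lemma emeasure_srw_avg:
  assumes "x \<in> V" "S \<in> sets (PiM UNIV (\<lambda>_. count_space UNIV))"
    and "\<And>y. y \<in> nbrs adj x \<Longrightarrow> emeasure (srw adj y) {X. case_nat x X \<in> S} = ennreal (g y)"
    and "\<And>y. y \<in> nbrs adj x \<Longrightarrow> 0 \<le> g y"
  shows "emeasure (srw adj x) S = ennreal (avg g x)"
  unfolding emeasure_srw_first_step[OF assms(2)] using assms by (intro nn_integral_nbrs)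

text \<open>Induction on the first step; the factor \<open>deg adj y\<close> undoes the
  normalisation of \<open>killed\<close>.\<close>

lemma emeasure_srw_killed:
  assumes "x \<in> V" "y \<in> V"
  shows "emeasure (srw adj x) {X. X t = y \<and> (\<forall>i\<le>t. X i \<in> B)} = ennreal (deg adj y * killed B t x y)"
  using assms(1)
proof (induction t arbitrary: x)
  case 0
  have "{X. X 0 = y \<and> (\<forall>i\<le>0::nat. X i \<in> B)} = (if y \<in> B then {X. \<forall>i\<le>0. X i = y} else {})"
    by auto
  then show ?case
    using emeasure_srw_cylinder[of adj x 0 "\<lambda>_. y"] deg_pos[OF assms(2)] by auto
next
  case (Suc t)
  have S: "{X. X n = y \<and> (\<forall>i\<le>n. X i \<in> B)} \<in> sets (PiM UNIV (\<lambda>_. count_space UNIV))" for n :: nat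
  proof -
    have "{X. X n = y \<and> (\<forall>i\<le>n. X i \<in> B)} = {X. \<forall>i\<le>n. X i \<in> (if i = n then {y} \<inter> B else B)}"
      by (auto split: if_splits)
    then show ?thesis
      using sets_srw_coordinates[of n "\<lambda>i. if i = n then {y} \<inter> B else B"] by simp
  qed
  have eq: "{X. case_nat x X \<in> {X. X (Suc t) = y \<and> (\<forall>i\<le>Suc t. X i \<in> B)}}
      = (if x \<in> B then {X. X t = y \<and> (\<forall>i\<le>t. X i \<in> B)} else {})"
    by (auto simp: less_Suc_eq_le[symmetric] All_less_Suc2)
  have "emeasure (srw adj x) {X. X (Suc t) = y \<and> (\<forall>i\<le>Suc t. X i \<in> B)}
      = ennreal (avg (\<lambda>z. of_bool (x \<in> B) * deg adj y * killed B t z y) x)"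
  proof (rule emeasure_srw_avg[OF Suc.prems S])
    fix z assume "z \<in> nbrs adj x"
    then show "emeasure (srw adj z) {X. case_nat x X \<in> {X. X (Suc t) = y \<and> (\<forall>i\<le>Suc t. X i \<in> B)}}
        = ennreal (of_bool (x \<in> B) * deg adj y * killed B t z y)"
      unfolding eq using Suc.IH[OF nbrs_in_V] by simp
  qed (simp add: killed_nonneg)
  then show ?case
    by (simp add: avg_cmult)
qed

lemma killed_kernel_eq:
  assumes "x \<in> V" "y \<in> V"
  shows "killed_kernel adj B t x y = ennreal (killed B t x y)"
proof -
  have "enat t < exit_time B X \<longleftrightarrow> (\<forall>i\<le>t. X i \<in> B)" for X :: "nat \<Rightarrow> 'a"
  proof -
    have "enat t < exit_time B X \<longleftrightarrow> enat (Suc t) \<le> exit_time B X"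
      by (simp add: Suc_ile_eq)
    also have "\<dots> \<longleftrightarrow> (\<forall>i. X i \<notin> B \<longrightarrow> t < i)"
      by (auto simp: exit_time_def le_Inf_iff Suc_le_eq)
    also have "\<dots> \<longleftrightarrow> (\<forall>i\<le>t. X i \<in> B)"
      by (meson not_le)
    finally show ?thesis .
  qed
  then show ?thesis
    using deg_pos[OF assms(2)]
    by (simp add: killed_kernel_def space_srw emeasure_srw_killed[OF assms] divide_ennreal
        killed_nonneg ennreal_of_nat_eq_real_of_nat)
qed

lemma hit_nonneg: "0 \<le> hit a T x"
  by (induction T arbitrary: x) (auto intro: avg_nonneg)

lemma sets_visit:
  "{X. \<exists>t<T. X (t + k) = a} \<in> sets (PiM UNIV (\<lambda>_::nat. count_space (UNIV::'a set)))"
proof -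
  have "{X \<in> space (PiM UNIV (\<lambda>_::nat. count_space (UNIV::'a set))). \<exists>t\<in>{..<T}. X (t + k) = a}
      \<in> sets (PiM UNIV (\<lambda>_::nat. count_space (UNIV::'a set)))"
    by measurable
  then show ?thesis
    by (simp add: space_PiM Bex_def)
qed

lemma emeasure_srw_hit:
  assumes "x \<in> V"
  shows "emeasure (srw adj x) {X. \<exists>t<T. X t = a} = ennreal (hit a T x)"
  using assms
proof (induction T arbitrary: x)
  case (Suc T)
  have eq: "{X. case_nat x X \<in> {X. \<exists>t<Suc T. X t = a}} = (if x = a then UNIV else {X. \<exists>t<T. X t = a})"
    by (auto simp: Ex_less_Suc2)
  have "emeasure (srw adj x) {X. \<exists>t<Suc T. X t = a} = ennreal (avg (\<lambda>y. if x = a then 1 else hit a T y) x)"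
  proof (rule emeasure_srw_avg[OF Suc.prems])
    show "emeasure (srw adj y) {X. case_nat x X \<in> {X. \<exists>t<Suc T. X t = a}} =
        ennreal (if x = a then 1 else hit a T y)" if "y \<in> nbrs adj x" for y
      unfolding eq using Suc.IH[OF nbrs_in_V[OF that]] prob_space.emeasure_space_1[OF prob_space_srw, of adj y]
      by (simp add: space_srw)
  qed (use sets_visit[of "Suc T" 0 a] hit_nonneg in auto)
  then show ?case
    using Suc.prems by (auto simp: avg_const)
qed simp

text \<open>A return by time \<open>T\<close> is a visit before \<open>T\<close> of the walk
  restarted after its first step; continuity from below does the rest.\<close>

lemma recurrent_imp_hit_tendsto_1:
  assumes "recurrent_graph V adj" "a \<in> V"
  shows "(\<lambda>T. avg (hit a T) a) \<longlonglongrightarrow> 1"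
proof -
  interpret prob_space "srw adj a"
    by (rule prob_space_srw)
  define R where "R T = {X. \<exists>t<T. X (t + 1) = a}" for T :: nat
  have sets_R: "R T \<in> sets (srw adj a)" for T
    unfolding R_def sets_srw by (rule sets_visit)
  have "emeasure (srw adj a) (R T) = ennreal (avg (hit a T) a)" for T
    using assms(2)
  proof (rule emeasure_srw_avg)
    show "emeasure (srw adj y) {X. case_nat a X \<in> R T} = ennreal (hit a T y)" if "y \<in> nbrs adj a" for y
      using emeasure_srw_hit[OF nbrs_in_V[OF that], of T a] by (simp add: R_def)
  qed (use sets_R[of T] hit_nonneg in \<open>auto simp: sets_srw\<close>)
  then have R: "prob (R T) = avg (hit a T) a" for T
    by (simp add: measure_def avg_nonneg hit_nonneg)
  have "(\<lambda>T. prob (R T)) \<longlonglongrightarrow> prob (\<Union>T. R T)"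
    using sets_R by (intro finite_Lim_measure_incseq) (force simp: R_def incseq_def)+
  moreover have "prob (\<Union>T. R T) = 1"
  proof (subst prob_eq_1)
    have "AE X in srw adj a. \<exists>t\<ge>1. X t = a"
      using assms by (auto simp: recurrent_graph_def)
    then show "AE X in srw adj a. X \<in> (\<Union>T. R T)"
    proof (rule AE_mp)
      show "AE X in srw adj a. (\<exists>t\<ge>1. X t = a) \<longrightarrow> X \<in> (\<Union>T. R T)"
      proof (intro AE_I2 impI)
        fix X :: "nat \<Rightarrow> 'a" assume "\<exists>t\<ge>1. X t = a"
        then obtain t where "t \<ge> 1" "X t = a"
          by blast
        then have "X \<in> R t"
          by (auto simp: R_def intro!: exI[of _ "t - 1"])
        then show "X \<in> (\<Union>T. R T)"
          by blast
      qed
    qed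
  qed (use sets_R in auto)
  ultimately show ?thesis
    by (simp add: R)
qed

section \<open>Two independent walks\<close>

abbreviation path_space :: "(nat \<Rightarrow> 'a) measure" where
  "path_space \<equiv> PiM UNIV (\<lambda>_. count_space UNIV)"

lemma sets_srw_pair: "sets (srw_pair adj a b) = sets (path_space \<Otimes>\<^sub>M path_space)"
  unfolding srw_pair_def by (intro sets_pair_measure_cong sets_srw)

lemma space_srw_pair: "space (srw_pair adj a b) = UNIV"
  by (simp add: srw_pair_def space_pair_measure space_srw)

lemma measurable_pair_coordinate_eq [measurable]:
  "Measurable.pred (path_space \<Otimes>\<^sub>M path_space) (\<lambda>p. fst p i = v)"
  "Measurable.pred (path_space \<Otimes>\<^sub>M path_space) (\<lambda>p. snd p i = v)"
  by (rule measurable_compose[OF measurable_fst] measurable_compose[OF measurable_snd]; measurable)+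

lemma sigma_finite_srw: "sigma_finite_measure (srw adj a)"
  using prob_space_srw by (rule prob_space_imp_sigma_finite)

text \<open>Joint Markov property for independent walks: by Fubini, the first step of one walk is
  taken in the outer integral and that of the other inside each slice \<open>g\<close>.\<close>

lemma emeasure_srw_pair_avg:
  assumes V: "a \<in> V" "b \<in> V" and S: "S \<in> sets (path_space \<Otimes>\<^sub>M path_space)"
    and h: "\<And>a' b'. a' \<in> nbrs adj a \<Longrightarrow> b' \<in> nbrs adj b \<Longrightarrow>
      emeasure (srw_pair adj a' b') {p. (case_nat a (fst p), case_nat b (snd p)) \<in> S} = ennreal (h a' b')"
    and nonneg: "\<And>a' b'. a' \<in> nbrs adj a \<Longrightarrow> b' \<in> nbrs adj b \<Longrightarrow> 0 \<le> h a' b'"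
  shows "emeasure (srw_pair adj a b) S = ennreal (avg (\<lambda>a'. avg (h a') b) a)"
proof -
  define g where "g y X = emeasure (srw adj y) {Y. (case_nat a X, case_nat b Y) \<in> S}" for y and X :: "nat \<Rightarrow> 'a"
  let ?S' = "{p. (case_nat a (fst p), case_nat b (snd p)) \<in> S}"
  have S': "?S' \<in> sets (srw adj x \<Otimes>\<^sub>M srw adj y)" for x y
  proof -
    have "(\<lambda>p. (case_nat a (fst p), case_nat b (snd p)))
        \<in> srw adj x \<Otimes>\<^sub>M srw adj y \<rightarrow>\<^sub>M path_space \<Otimes>\<^sub>M path_space"
      by measurable
    from measurable_sets[OF this S] show ?thesis
      by (simp add: space_pair_measure space_srw vimage_def)
  qed
  have slice: "emeasure (srw adj x \<Otimes>\<^sub>M srw adj y) T = (\<integral>\<^sup>+X. emeasure (srw adj y) {Y. (X, Y) \<in> T} \<partial>srw adj x)"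
    and slice_meas: "(\<lambda>X. emeasure (srw adj y) {Y. (X, Y) \<in> T}) \<in> borel_measurable (srw adj x)"
    if "T \<in> sets (srw adj x \<Otimes>\<^sub>M srw adj y)" for T x y
    using sigma_finite_measure.emeasure_pair_measure_alt[OF sigma_finite_srw that]
      sigma_finite_measure.measurable_emeasure_Pair[OF sigma_finite_srw that]
    by (simp_all add: vimage_def)
  have Sab: "S \<in> sets (srw adj x \<Otimes>\<^sub>M srw adj y)" for x y
    using S sets_srw_pair[of x y] by (simp add: srw_pair_def)
  have g_meas: "g y \<in> borel_measurable (srw adj x)" for x y
    using slice_meas[OF S', of y x] by (simp add: g_def[abs_def])
  have Sx: "{Y. (X, Y) \<in> S} \<in> sets path_space" for X
    using sets_Pair1[OF S, of X] by (simp add: vimage_def)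
  have "emeasure (srw_pair adj a b) S = (\<integral>\<^sup>+X. emeasure (srw adj b) {Y. (X, Y) \<in> S} \<partial>srw adj a)"
    unfolding srw_pair_def by (rule slice[OF Sab])
  also have "\<dots> = (\<integral>\<^sup>+a'. (\<integral>\<^sup>+X. emeasure (srw adj b) {Y. (case_nat a X, Y) \<in> S} \<partial>srw adj a') \<partial>pmf_of_set (nbrs adj a))"
    using slice_meas[OF Sab, of b a] by (intro nn_integral_srw_first_step) (simp cong: measurable_cong_sets add: sets_srw)
  also have "\<dots> = (\<integral>\<^sup>+a'. (\<integral>\<^sup>+X. (\<Sum>b'\<in>nbrs adj b. g b' X) / deg adj b \<partial>srw adj a') \<partial>pmf_of_set (nbrs adj a))"
    by (simp add: emeasure_srw_first_step[OF Sx] g_def nn_integral_nbrs_sum[OF V(2)])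
  also have "\<dots> = (\<integral>\<^sup>+a'. (\<Sum>b'\<in>nbrs adj b. (\<integral>\<^sup>+X. g b' X \<partial>srw adj a')) / deg adj b \<partial>pmf_of_set (nbrs adj a))"
    using g_meas by (simp add: nn_integral_divide nn_integral_sum)
  also have "\<dots> = (\<integral>\<^sup>+a'. (\<integral>\<^sup>+b'. emeasure (srw_pair adj a' b') ?S' \<partial>pmf_of_set (nbrs adj b)) \<partial>pmf_of_set (nbrs adj a))"
    unfolding srw_pair_def slice[OF S'] by (simp add: g_def nn_integral_nbrs_sum[OF V(2)])
  also have "\<dots> = ennreal (avg (\<lambda>a'. avg (h a') b) a)"
    using V h nonneg by (intro nn_integral_nbrs avg_nonneg)
  finally show ?thesis .
qed

text \<open>Collisions are restricted to the countable set \<^term>\<open>V\<close> because the diagonal of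
  an uncountable type need not be measurable in the product of two counting measures.\<close>

definition edge_coll :: "nat \<Rightarrow> (nat \<Rightarrow> 'a) \<times> (nat \<Rightarrow> 'a) \<Rightarrow> bool" where
  "edge_coll t p \<longleftrightarrow> (\<exists>v\<in>V. \<exists>w\<in>V. fst p t = v \<and> snd p t = v \<and> fst p (Suc t) = w \<and> snd p (Suc t) = w)"

lemma measurable_edge_coll:
  assumes "countable V"
  shows "Measurable.pred (path_space \<Otimes>\<^sub>M path_space) (edge_coll t)"
  unfolding edge_coll_def[abs_def]
  by (intro measurable_pred_countable(2)[OF assms] pred_intros_logic measurable_pair_coordinate_eq)

text \<open>The predicate \<open>P\<close> on times covers both uses, \<open>t < T\<close> and
  \<open>t \<ge> n\<close>.\<close>

lemma sets_no_edge_coll: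
  assumes "countable V"
  shows "{p. \<forall>t. P t \<longrightarrow> \<not> edge_coll t p} \<in> sets (path_space \<Otimes>\<^sub>M path_space)"
proof -
  note [measurable] = measurable_edge_coll[OF assms]
  have "{p \<in> space (path_space \<Otimes>\<^sub>M path_space). \<forall>t. P t \<longrightarrow> \<not> edge_coll t p} \<in> sets (path_space \<Otimes>\<^sub>M path_space)"
    by measurable
  then show ?thesis
    by (simp add: space_pair_measure space_PiM)
qed

lemma edge_coll_shift:
  "edge_coll (Suc t) (case_nat a (fst p), case_nat b (snd p)) \<longleftrightarrow> edge_coll t p"
  by (simp add: edge_coll_def)

lemma AE_srw_pair_start:
  "AE p in srw_pair adj a b. fst p 0 = a \<and> snd p 0 = b"
proof -
  have "{p \<in> space (path_space \<Otimes>\<^sub>M path_space). fst p 0 = a \<and> snd p 0 = b} \<in> sets (path_space \<Otimes>\<^sub>M path_space)"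
    by measurable
  then have "{p \<in> space (srw adj a \<Otimes>\<^sub>M srw adj b). fst p 0 = a \<and> snd p 0 = b} \<in> sets (srw adj a \<Otimes>\<^sub>M srw adj b)"
    using sets_srw_pair[of a b] by (simp add: srw_pair_def space_pair_measure space_srw space_PiM)
  then show ?thesis
    unfolding srw_pair_def
    using AE_srw_start[of a adj] AE_srw_start[of b adj]
    by (intro pair_sigma_finite.AE_pair_measure pair_sigma_finite.intro sigma_finite_srw) auto
qed

lemma emeasure_no_coll:
  assumes "countable V" "a \<in> V" "b \<in> V"
  shows "emeasure (srw_pair adj a b) {p. \<forall>t<T. \<not> edge_coll t p} = ennreal (no_coll T a b)"
  using assms(2,3)
proof (induction T arbitrary: a b)
  case 0
  have "prob_space (srw_pair adj a b)"
    unfolding srw_pair_def using prob_space_srw by (intro prob_space_pair)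
  then show ?case
    using prob_space.emeasure_space_1[of "srw_pair adj a b"] by (simp add: space_srw_pair)
next
  case (Suc T)
  note meas = sets_no_edge_coll[OF assms(1)]
  show ?case
    unfolding no_coll.simps
  proof (rule emeasure_srw_pair_avg[OF Suc.prems meas])
    fix a' b' assume ab': "a' \<in> nbrs adj a" "b' \<in> nbrs adj b"
    then have V': "a' \<in> V" "b' \<in> V"
      using nbrs_in_V by auto
    let ?sh = "\<lambda>p. (case_nat a (fst p), case_nat b (snd p))"
    let ?A = "{p. ?sh p \<in> {p. \<forall>t<Suc T. \<not> edge_coll t p}}"
    \<comment> \<open>The crossing at time 0 of the prepended pair is determined by
      \<open>a\<close>, \<open>b\<close> and the starting points \<open>a'\<close>,
      \<open>b'\<close>, which are only almost surely attained; the two events are therefore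
      compared almost everywhere.\<close>
    let ?B = "if a = b \<and> a' = b' then {} else {p. \<forall>t<T. \<not> edge_coll t p}"
    have "?sh \<in> srw adj a' \<Otimes>\<^sub>M srw adj b' \<rightarrow>\<^sub>M path_space \<Otimes>\<^sub>M path_space"
      by measurable
    from measurable_sets[OF this meas[of "\<lambda>t. t < Suc T"]]
    have "?A \<in> sets (srw_pair adj a' b')"
      by (simp add: srw_pair_def space_pair_measure space_srw vimage_def)
    moreover have "?B \<in> sets (srw_pair adj a' b')"
      using meas[of "\<lambda>t. t < T"] by (simp add: sets_srw_pair)
    moreover have "AE p in srw_pair adj a' b'. p \<in> ?A \<longleftrightarrow> p \<in> ?B"
    proof (rule AE_mp[OF AE_srw_pair_start AE_I2], intro impI)
      fix p :: "(nat \<Rightarrow> 'a) \<times> (nat \<Rightarrow> 'a)" assume p: "fst p 0 = a' \<and> snd p 0 = b'"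
      have "edge_coll 0 (?sh p) \<longleftrightarrow> a = b \<and> a' = b'"
        using p V' Suc.prems by (auto simp: edge_coll_def)
      then show "p \<in> ?A \<longleftrightarrow> p \<in> ?B"
        by (auto simp: All_less_Suc2 edge_coll_shift)
    qed
    ultimately have "emeasure (srw_pair adj a' b') ?A = emeasure (srw_pair adj a' b') ?B"
      by (intro emeasure_eq_AE)
    then show "emeasure (srw_pair adj a' b') ?A
        = ennreal (of_bool (\<not> (a = b \<and> a' = b')) * no_coll T a' b')"
      using Suc.IH[OF V'] by auto
  qed (simp add: no_coll_nonneg)
qed

text \<open>For \<open>n = 0\<close> the event lies in every finite-horizon one. Each further step
  moves both walks, and \<open>even_connected_step\<close> keeps the new pair admissible.\<close>

lemma emeasure_no_coll_after:
  assumes "countable V"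
    and lim: "\<And>a b. a \<in> V \<Longrightarrow> b \<in> V \<Longrightarrow> even_connected a b \<Longrightarrow> (\<lambda>T. no_coll T a b) \<longlonglongrightarrow> 0"
    and "a \<in> V" "b \<in> V" "even_connected a b"
  shows "emeasure (srw_pair adj a b) {p. \<forall>t\<ge>n. \<not> edge_coll t p} = 0"
  using assms(3-5)
proof (induction n arbitrary: a b)
  case 0
  note meas = sets_no_edge_coll[OF assms(1)]
  have "emeasure (srw_pair adj a b) {p. \<forall>t\<ge>0. \<not> edge_coll t p} \<le> ennreal (no_coll T a b)" for T
    unfolding emeasure_no_coll[OF assms(1) 0(1,2), of T, symmetric]
    using meas[of "\<lambda>t. t < T"] by (intro emeasure_mono) (auto simp: sets_srw_pair)
  moreover have "(\<lambda>T. ennreal (no_coll T a b)) \<longlonglongrightarrow> ennreal 0"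
    using lim[OF 0] by (rule tendsto_ennrealI)
  ultimately have "emeasure (srw_pair adj a b) {p. \<forall>t\<ge>0. \<not> edge_coll t p} \<le> ennreal 0"
    by (intro LIMSEQ_le_const) auto
  then show ?case
    by simp
next
  case (Suc n)
  have eq: "{p. \<forall>t\<ge>Suc n. \<not> edge_coll t (case_nat a (fst p), case_nat b (snd p))}
      = {p. \<forall>t\<ge>n. \<not> edge_coll t p}"
  proof -
    have "(\<forall>t\<ge>Suc n. P t) \<longleftrightarrow> (\<forall>t\<ge>n. P (Suc t))" for P
      by (metis Suc_le_D Suc_le_mono)
    then show ?thesis
      by (simp add: edge_coll_shift)
  qed
  have "emeasure (srw_pair adj a b) {p. \<forall>t\<ge>Suc n. \<not> edge_coll t p} = ennreal (avg (\<lambda>a'. avg (\<lambda>b'. 0) b) a)"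
    using Suc nbrs_in_V even_connected_step[OF Suc.prems(3)]
    by (intro emeasure_srw_pair_avg sets_no_edge_coll[OF assms(1)]) (auto simp: eq mem_nbrs)
  then show ?case
    using Suc.prems by (simp add: avg_const)
qed

lemma AE_infinitely_many_edge_coll:
  assumes "countable V"
    and "\<And>a b. a \<in> V \<Longrightarrow> b \<in> V \<Longrightarrow> even_connected a b \<Longrightarrow> (\<lambda>T. no_coll T a b) \<longlonglongrightarrow> 0"
    and "a \<in> V"
  shows "AE p in srw_pair adj a a. \<forall>n. \<exists>t\<ge>n. edge_coll t p"
proof -
  have "AE p in srw_pair adj a a. \<exists>t\<ge>n. edge_coll t p" for n
  proof (rule AE_I)
    show "emeasure (srw_pair adj a a) {p. \<forall>t\<ge>n. \<not> edge_coll t p} = 0"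
      using assms by (intro emeasure_no_coll_after) auto
    show "{p. \<forall>t\<ge>n. \<not> edge_coll t p} \<in> sets (srw_pair adj a a)"
      using sets_no_edge_coll[OF assms(1)] by (simp add: sets_srw_pair)
  qed auto
  then show ?thesis
    by (simp add: AE_all_countable)
qed

text \<open>Local finiteness makes the set reached in \<open>n\<close> steps finite. Countability is
  what makes \<open>edge_coll\<close> measurable.\<close>

lemma countable_of_connected:
  assumes "connected_graph V adj"
  shows "countable V"
proof (cases "V = {}")
  case False
  then obtain a where a: "a \<in> V"
    by blast
  have "finite {y. (adj ^^ n) a y}" for n
  proof (induction n)
    case (Suc n)
    have "{y. (adj ^^ Suc n) a y} = (\<Union>x\<in>{y. (adj ^^ n) a y}. nbrs adj x)"
      by (auto simp: mem_nbrs)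
    then show ?case
      using Suc by simp
  qed simp
  then have "countable (\<Union>n. {y. (adj ^^ n) a y})"
    by (intro countable_UN countableI_type countable_finite)
  moreover have "V \<subseteq> (\<Union>n. {y. (adj ^^ n) a y})"
    using assms a by (auto simp: connected_graph_def rtranclp_power)
  ultimately show ?thesis
    by (rule countable_subset[rotated])
qed simp

lemma edge_collisions_infinite:
  assumes "\<forall>n. \<exists>t\<ge>n. edge_coll t (X, Y)"
  shows "collisions X Y = \<infinity>" "edge_collisions X Y = \<infinity>"
proof -
  have coll: "X t = Y t \<and> X (Suc t) = Y (Suc t)" if "edge_coll t (X, Y)" for t
    using that by (auto simp: edge_coll_def)
  show "collisions X Y = \<infinity>"
    unfolding collisions_def by (rule suminf_of_bool_infinite) (use assms coll in blast)
  show "edge_collisions X Y = \<infinity>"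
    unfolding edge_collisions_def by (rule suminf_of_bool_infinite) (use assms coll in blast)
qed

end

section \<open>Isolated vertices and the infinite collision property\<close>

lemma isolated_vertex_unique:
  assumes "connected_graph V adj" "x \<in> V" "nbrs adj x = {}"
  shows "V = {x}"
proof -
  have "y = x" if "y \<in> V" for y
  proof -
    have "adj\<^sup>*\<^sup>* x y"
      using assms(1,2) that by (auto simp: connected_graph_def)
    moreover have "\<not> adj x z" for z
      using assms(3) by (auto simp: nbrs_def)
    ultimately show ?thesis
      by (metis converse_rtranclpE)
  qed
  then show ?thesis
    using assms(2) by blast
qed

theorem theorem3p1:
  fixes V :: "'a set" and adj :: "'a \<Rightarrow> 'a \<Rightarrow> bool" and o\<^sub>G :: 'a and B :: "nat \<Rightarrow> 'a set"
  assumes "locally_finite_graph V adj"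
    and "connected_graph V adj"
    and "recurrent_graph V adj"
    and "o\<^sub>G \<in> V"
    and "incseq B"
    and "\<And>r. B r \<noteq> V"
    and "(\<Union>r. B r) = V"
    and "\<exists>C<\<infinity>. \<forall>r. \<forall>x\<in>B r. green adj (B r) x x \<le> C * green adj (B r) o\<^sub>G o\<^sub>G"
  shows "infinite_collision_property V adj \<and>
    (\<forall>a\<in>V. AE (X, Y) in srw_pair adj a a. edge_collisions X Y = \<infinity>)"
proof -
  interpret locally_finite_graph V adj
    by (rule assms(1))
  \<comment> \<open>An isolated vertex would make \<open>V\<close> a single point, and then the set
    \<open>B r\<close> containing it would be all of \<open>V\<close>.\<close>
  interpret graph_without_isolated_vertices V adj
  proof
    fix x assume x: "x \<in> V"
    obtain r where r: "x \<in> B r"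
      using x assms(7) by auto
    show "nbrs adj x \<noteq> {}"
    proof
      assume "nbrs adj x = {}"
      then have "V = {x}"
        by (rule isolated_vertex_unique[OF assms(2) x])
      then have "B r = V"
        using r assms(7) by blast
      then show False
        using assms(6) by blast
    qed
  qed
  have BV: "B r \<subseteq> V" for r
    using assms(7) by blast
  have green: "green adj (B r) x x = (\<Sum>t. ennreal (killed (B r) t x x))" if "x \<in> V" for r x
    unfolding green_def using killed_kernel_eq[OF that that] by simp
  have gsum_le_green: "ennreal (gsum (B r) T x x) \<le> green adj (B r) x x" if "x \<in> V" for r T x
    unfolding gsum_def green[OF that] by (subst sum_ennreal[symmetric]) (simp_all add: killed_nonneg sum_le_suminf del: sum_ennreal)
  define G where "G r = lim (\<lambda>T. gsum (B r) T o\<^sub>G o\<^sub>G)" for r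
  have G: "(\<lambda>T. gsum (B r) T o\<^sub>G o\<^sub>G) \<longlonglongrightarrow> G r" for r
  proof -
    \<comment> \<open>The kernel vanishes at a vertex \<open>b\<close> outside \<open>B r\<close>,
      so the gradient bound from the root to \<open>b\<close> bounds \<open>gsum\<close> at the root
      for every \<open>T\<close>.\<close>
    obtain b where b: "b \<in> V" "b \<notin> B r"
      using assms(6)[of r] BV[of r] by blast
    have "adj\<^sup>*\<^sup>* o\<^sub>G b"
      using assms(2,4) b by (auto simp: connected_graph_def)
    from gsum_gradient[OF assms(4) this] obtain K where "\<And>T. gsum (B r) T o\<^sub>G o\<^sub>G \<le> gsum (B r) T b o\<^sub>G + K"
      by auto
    then have "\<And>T. gsum (B r) T o\<^sub>G o\<^sub>G \<le> K"
      using b by (simp add: gsum_outside)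
    moreover have "incseq (\<lambda>T. gsum (B r) T o\<^sub>G o\<^sub>G)"
      by (simp add: incseq_def gsum_mono)
    ultimately have "convergent (\<lambda>T. gsum (B r) T o\<^sub>G o\<^sub>G)"
      using incseq_convergent convergentI by blast
    then show ?thesis
      by (simp add: G_def convergent_LIMSEQ_iff)
  qed
  have G_nonneg: "0 \<le> G r" for r
    using gsum_nonneg by (intro LIMSEQ_le_const[OF G]) auto
  \<comment> \<open>The Green kernel at the root is thus finite, and the assumed bound becomes an
    inequality between reals.\<close>
  have green_G: "green adj (B r) o\<^sub>G o\<^sub>G = ennreal (G r)" for r
    unfolding green[OF assms(4)] using G[of r]
    by (intro suminf_ennreal_eq) (auto simp: killed_nonneg gsum_def sums_def)
  obtain C' where C': "C' < \<infinity>" "\<And>r x. x \<in> B r \<Longrightarrow> green adj (B r) x x \<le> C' * green adj (B r) o\<^sub>G o\<^sub>G"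
    using assms(8) by blast
  then obtain C where C: "C' = ennreal C" "0 \<le> C"
    by (cases C') auto
  have bound: "gsum (B r) T x x \<le> C * G r" if "x \<in> B r" for r T x
  proof -
    have "ennreal (gsum (B r) T x x) \<le> ennreal C * ennreal (G r)"
      using gsum_le_green[of x r T] C'(2)[OF that] BV that unfolding C(1) green_G by (meson order_trans subsetD)
    then show ?thesis
      using C(2) G_nonneg[of r] by (simp add: ennreal_mult[symmetric])
  qed
  have lim: "(\<lambda>T. no_coll T a b) \<longlonglongrightarrow> 0" if "a \<in> V" "b \<in> V" "(adj OO adj)\<^sup>*\<^sup>* a b" for a b
  proof (rule no_coll_tendsto_0[OF _ _ that])
    show "0 < 1 / (8 * (1 + C))"
      using C(2) by simp
    show "\<exists>T. no_coll T a b \<le> 1 - 1 / (8 * (1 + C))" if "a \<in> V" "b \<in> V" "(adj OO adj)\<^sup>*\<^sup>* a b" for a b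
      using no_coll_uniform_bound[OF assms(2,5,7,4) recurrent_imp_hit_tendsto_1[OF assms(3,4)] C(2) G bound that] .
  qed
  have inf: "AE p in srw_pair adj a a. \<forall>n. \<exists>t\<ge>n. edge_coll t p" if "a \<in> V" for a
    using that by (intro AE_infinitely_many_edge_coll countable_of_connected assms(2) lim)
  have "AE (X, Y) in srw_pair adj a a. collisions X Y = \<infinity>"
    and "AE (X, Y) in srw_pair adj a a. edge_collisions X Y = \<infinity>" if "a \<in> V" for a
    by (rule eventually_mono[OF inf[OF that]]; clarsimp simp: edge_collisions_infinite)+
  then show ?thesis
    unfolding infinite_collision_property_def by blast
qed

end
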